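(* Let $\mathbb{F}$ be a finite field of order $q$, $\theta$ a non-trivial additive character of $\mathbb{F}$, and $0\le n\le m$ integers. Let $\varPhi_{n,m}$ be the canonical matrix of the pair $(\operatorname{Mat}_{n,m}(\mathbb{F}),\operatorname{GL}_n(\mathbb{F})\times\operatorname{GL}_m(\mathbb{F}))$. Let $k\ge1$ and let $0\le r_1,\dots,r_k,r\le n$ be integers such that $\sum_{i=1}^kr_i\le r$. Then $$\sum_{s=0}^n(-1)^sq^{\binom s2}(q^m;q^{-1})_s\begin{bmatrix} n \\ s \end{bmatrix}_q\Big(\prod_{i=1}^k\varPhi_{n,m}(s,r_i)\Big)\varPhi_{n,m}(s,r)=\delta_{\sum_ir_i,\,r}\cdot(-1)^rq^{nm+\binom r2+\sum_{i<j}r_ir_j}\,\frac{(q^m;q^{-1})_r\,(q^n;q^{-1})_r}{\prod_{i=1}^k(q;q)_{r_i}},$$ where $\delta$ is Kronecker's delta.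
   Context: $\operatorname{Mat}_{n,m}(\mathbb{F})$ is the additive group of $n\times m$ matrices, with $\operatorname{GL}_n(\mathbb{F})\times\operatorname{GL}_m(\mathbb{F})$ acting by $(g,h)\cdot a=ga\,{}^th$, and $\langle a|b\rangle=\operatorname{trace}({}^tab)$. The canonical matrix is $$\varPhi_{n,m}(s,r)=\sum_{b\in\operatorname{Mat}_{n,m}(\mathbb{F}),\ \operatorname{rank}b=r}\overline{\theta(\langle a|b\rangle)},\qquad a\text{ any matrix with }\operatorname{rank}a=s$$ (independent of the choice of $a$). Notation: $(a;q)_k=(1-a)(1-aq)\cdots(1-aq^{k-1})$, $(a;q)_0=1$; $\begin{bmatrix} N \\ x \end{bmatrix}_q=\dfrac{(q^N;q^{-1})_x}{(q;q)_x}$. *)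

theory Defs
  imports Complex_Main "HOL-Library.Cardinality" "Jordan_Normal_Form.DL_Rank"
begin

definition nontrivial_additive_character :: "('a::field \<Rightarrow> complex) \<Rightarrow> bool" where
  "nontrivial_additive_character \<theta> \<longleftrightarrow>
     (\<forall>x. \<theta> x \<noteq> 0) \<and> (\<forall>x y. \<theta> (x + y) = \<theta> x * \<theta> y) \<and> (\<exists>x. \<theta> x \<noteq> 1)"

definition mat_trace :: "'a::comm_monoid_add mat \<Rightarrow> 'a" where
  "mat_trace A = (\<Sum>i<dim_row A. A $$ (i, i))"

definition mat_pairing :: "'a::field mat \<Rightarrow> 'a mat \<Rightarrow> 'a" where
  "mat_pairing a b = mat_trace (transpose_mat a * b)"

text \<open>The argument of \<^const>\<open>vec_space.rank\<close> is the dimension of the column vectors,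
  i.e. the number of rows.\<close>

definition rank_mats :: "nat \<Rightarrow> nat \<Rightarrow> nat \<Rightarrow> 'a::field mat set" where
  "rank_mats n m r = {a \<in> carrier_mat n m. vec_space.rank n a = r}"

text \<open>The sum depends on \<open>a\<close> only through its rank, so the choice of \<open>a\<close> is immaterial.
  For \<open>n \<le> m\<close> such an \<open>a\<close> exists exactly when \<open>s \<le> n\<close>; other values of \<open>s\<close> are not meaningful.\<close>

definition canonical_matrix ::
    "('a::{field,finite} \<Rightarrow> complex) \<Rightarrow> nat \<Rightarrow> nat \<Rightarrow> nat \<Rightarrow> nat \<Rightarrow> complex" where
  "canonical_matrix \<theta> n m s r =
     (let a = (SOME a. a \<in> rank_mats n m s)
      in \<Sum>b\<in>rank_mats n m r. cnj (\<theta> (mat_pairing a b)))"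

definition q_pochhammer :: "'b::field \<Rightarrow> 'b \<Rightarrow> nat \<Rightarrow> 'b" where
  "q_pochhammer a q k = (\<Prod>i<k. 1 - a * q ^ i)"

definition q_binomial :: "'b::field \<Rightarrow> nat \<Rightarrow> nat \<Rightarrow> 'b" where
  "q_binomial q N x = q_pochhammer (q ^ N) (inverse q) x / q_pochhammer q q x"

end

theory Submission
  imports Defs "Jordan_Normal_Form.Matrix_Kernel" "HOL-Computational_Algebra.Polynomial"
begin

text \<open>The coefficient of the \<open>s\<close>-th summand is the number of matrices of rank \<open>s\<close>, so the left-hand
  side is the sum over all matrices \<open>a\<close> of \<open>F\<^sub>r(a) \<Prod>\<^sub>i F\<^sub>r\<^sub>i(a)\<close>, where \<open>F\<^sub>t(a)\<close> is the sum of the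
  values \<open>\<chi>\<langle>a|b\<rangle>\<close>, with \<open>\<chi>\<close> the conjugate of \<open>\<theta>\<close>, over the matrices \<open>b\<close> of rank \<open>t\<close>. By character orthogonality the \<open>F\<^sub>t\<close> are
  orthogonal. Multiplying \<open>F\<^sub>t(a)\<close> by \<open>u(a)\<close>, the sum of the \<open>\<chi>\<langle>a|x y\<^sup>T\<rangle>\<close> over all vectors \<open>x\<close>, \<open>y\<close>, and
  counting how rank-one perturbations change the rank gives a three-term recurrence; hence a
  constant multiple of \<open>F\<^sub>t(a)\<close> is a monic polynomial of degree \<open>t\<close> in \<open>u(a)\<close>. As \<open>u(a)\<close> is determined by the
  size of the kernel of \<open>a\<close>, this also shows that \<open>F\<^sub>t(a)\<close> depends only on the rank of \<open>a\<close>. The product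
  over \<open>i\<close> is then a monic polynomial of degree \<open>\<Sum>\<^sub>i r\<^sub>i \<le> r\<close> up to a constant, and only its
  coefficient of degree \<open>r\<close> contributes to the sum against \<open>F\<^sub>r\<close>.\<close>

subsection \<open>Cardinalities of vector and matrix spaces\<close>

lemma vec_image_PiE: "carrier_vec n = vec n ` ({..<n} \<rightarrow>\<^sub>E UNIV)"
proof (intro equalityI subsetI)
  fix v :: "'a vec" assume "v \<in> carrier_vec n"
  then have "v = vec n (restrict (($) v) {..<n})" by (intro eq_vecI) auto
  then show "v \<in> vec n ` ({..<n} \<rightarrow>\<^sub>E UNIV)"
    by (rule image_eqI[where f = "vec n"]) auto
qed (erule imageE, simp)

lemma mat_image_PiE: "carrier_mat n m = mat n m ` ({..<n} \<times> {..<m} \<rightarrow>\<^sub>E UNIV)"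
proof (intro equalityI subsetI)
  fix A :: "'a mat" assume "A \<in> carrier_mat n m"
  then have "A = mat n m (restrict (($$) A) ({..<n} \<times> {..<m}))" by (intro eq_matI) auto
  then show "A \<in> mat n m ` ({..<n} \<times> {..<m} \<rightarrow>\<^sub>E UNIV)"
    by (rule image_eqI[where f = "mat n m"]) auto
qed (erule imageE, simp)

lemma finite_carrier_vec [simp]: "finite (carrier_vec n :: 'a::finite vec set)"
  by (simp add: vec_image_PiE finite_PiE)

lemma finite_carrier_mat [simp]: "finite (carrier_mat n m :: 'a::finite mat set)"
  by (simp add: mat_image_PiE finite_PiE)

lemma card_carrier_vec: "card (carrier_vec n :: 'a::finite vec set) = CARD('a) ^ n"
proof -
  have "inj_on (vec n :: (nat \<Rightarrow> 'a) \<Rightarrow> _) ({..<n} \<rightarrow>\<^sub>E UNIV)"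
  proof (intro inj_onI PiE_ext)
    fix f g :: "nat \<Rightarrow> 'a" and i assume "vec n f = vec n g" "i \<in> {..<n}"
    then show "f i = g i" by (metis index_vec lessThan_iff)
  qed auto
  then show ?thesis by (simp add: vec_image_PiE card_image card_PiE)
qed

lemma card_carrier_mat: "card (carrier_mat n m :: 'a::finite mat set) = CARD('a) ^ (n * m)"
proof -
  have "inj_on (mat n m :: (nat \<times> nat \<Rightarrow> 'a) \<Rightarrow> _) ({..<n} \<times> {..<m} \<rightarrow>\<^sub>E UNIV)"
  proof (intro inj_onI PiE_ext)
    fix f g :: "nat \<times> nat \<Rightarrow> 'a" and p assume "mat n m f = mat n m g" "p \<in> {..<n} \<times> {..<m}"
    then show "f p = g p" by (cases p) (metis SigmaD1 SigmaD2 index_mat(1) lessThan_iff)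
  qed auto
  then show ?thesis by (simp add: mat_image_PiE card_image card_PiE)
qed

text \<open>Meant for linear maps and functionals, whose nonempty fibres all have the same
  size.\<close>

lemma card_eq_card_image_mult:
  assumes "finite A" and "\<And>z. z \<in> f ` A \<Longrightarrow> card {x \<in> A. f x = z} = c"
  shows "card A = card (f ` A) * c"
proof -
  have "card A = (\<Sum>z\<in>f ` A. \<Sum>x | x \<in> A \<and> f x = z. 1)"
    using sum.image_gen[OF assms(1), of "\<lambda>_. 1::nat" f] by simp
  also have "\<dots> = card (f ` A) * c" by (simp add: assms(2))
  finally show ?thesis .
qed

lemma card_field_ge_2: "CARD('a::{field,finite}) \<ge> 2"
proof -
  have "card {0, 1::'a} \<le> CARD('a)" by (rule card_mono) auto
  then show ?thesis by simp
qed

text \<open>A maximal independent set of columns spans the column space and has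
  \<open>rank A\<close> elements; multiplication by the matrix of these columns is injective with
  the column space as its image. This lets ranks be handled through cardinalities.\<close>

lemma card_range_mult_mat_vec:
  fixes A :: "'a::{field,finite} mat"
  assumes A: "A \<in> carrier_mat n m"
  shows "card ((*\<^sub>v) A ` carrier_vec m) = CARD('a) ^ vec_space.rank n A"
proof -
  interpret vec_space "TYPE('a)" n .
  have cA: "set (cols A) \<subseteq> carrier_vec n" using A cols_dim by blast
  obtain S where max: "maximal S (\<lambda>T. T \<subseteq> set (cols A) \<and> lin_indpt T)" "finite S"
    using maximal_exists_superset[of "set (cols A)" "\<lambda>T. T \<subseteq> set (cols A) \<and> lin_indpt T" "{}"]
      finite_lin_indpt2[of "{}"] by auto
  then have S: "S \<subseteq> set (cols A)" "lin_indpt S" by (auto simp: maximal_def)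
  have Sn: "S \<subseteq> carrier_vec n" using S cA by blast
  \<comment> \<open>A column outside the span could be added to \<open>S\<close>, against
    maximality.\<close>
  have "set (cols A) \<subseteq> span S"
  proof
    fix s assume s: "s \<in> set (cols A)"
    show "s \<in> span S"
    proof (rule ccontr)
      assume ns: "s \<notin> span S"
      then have "lin_indpt (S \<union> {s})"
        using lin_dep_iff_in_span[OF Sn S(2), of s] subsetD[OF cA s] span_mem[OF Sn, of s] by auto
      moreover have "S \<union> {s} \<subseteq> set (cols A)" using S s by auto
      ultimately have "S \<union> {s} = S" using max(1) unfolding maximal_def by blast
      then show False using ns span_mem[OF Sn] by blast
    qed
  qed
  then have span: "span (set (cols A)) = span S"
    by (meson S(1) Sn span_is_monotone span_is_submodule span_is_subset subset_antisym)
  obtain bs where bs: "set bs = S" "distinct bs" using max(2) finite_distinct_list by blast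
  define B where "B = mat_of_cols n bs"
  have B: "B \<in> carrier_mat n (length bs)" and cB: "cols B = bs"
    using Sn bs by (auto simp: B_def)
  have inj: "inj_on ((*\<^sub>v) B) (carrier_vec (length bs))"
  proof (rule inj_onI)
    fix v w assume vw: "v \<in> carrier_vec (length bs)" "w \<in> carrier_vec (length bs)"
      and "B *\<^sub>v v = B *\<^sub>v w"
    then have "B *\<^sub>v (v - w) = 0\<^sub>v n"
      using B by (simp add: mult_minus_distrib_mat_vec)
    moreover have "v - w \<in> carrier_vec (length bs)" using vw by auto
    ultimately have "v - w = 0\<^sub>v (length bs)"
      using lin_depI[OF B, of "v - w"] cB bs S by auto
    then have "v $ i - w $ i = 0" if "i < length bs" for i
      using vw that by (metis carrier_vecD index_minus_vec(1) index_zero_vec(1))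
    then show "v = w" using vw by (intro eq_vecI) auto
  qed
  have rng: "(*\<^sub>v) M ` carrier_vec l = col_space M" if M: "M \<in> carrier_mat n l" for M l
  proof -
    have "col_space M = {y \<in> carrier_vec n. \<exists>x\<in>carrier_vec l. M *\<^sub>v x = y}"
      using col_space_eq[OF M] carrier_matD[OF M] by simp
    moreover have "M *\<^sub>v x \<in> carrier_vec n" if "x \<in> carrier_vec l" for x
      by (rule mult_mat_vec_carrier[OF M that])
    ultimately show ?thesis by (simp add: image_def) metis
  qed
  have "card ((*\<^sub>v) B ` carrier_vec (length bs)) = CARD('a) ^ length bs"
    by (simp add: card_image[OF inj] card_carrier_vec)
  moreover have "(*\<^sub>v) B ` carrier_vec (length bs) = span S"
    using rng[OF B] by (simp only: col_space_def cB bs)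
  moreover have "(*\<^sub>v) A ` carrier_vec m = span S"
    using rng[OF A] by (simp only: col_space_def span)
  moreover have "length bs = rank A"
    using rank_card_indpt[OF A max(1)] bs distinct_card by metis
  ultimately show ?thesis by simp
qed

section \<open>Rank and nullity by counting\<close>

lemma vec_add_cancel [simp]:
  fixes x u :: "'a::ab_group_add vec"
  assumes "x \<in> carrier_vec m" "u \<in> carrier_vec m"
  shows "x + u - u = x" "x - u + u = x" "x + u + - u = x" "x + - u + u = x"
  using assms by - (rule eq_vecI; simp)+

lemma mat_kernel_iff: "A \<in> carrier_mat n m \<Longrightarrow>
    v \<in> mat_kernel A \<longleftrightarrow> v \<in> carrier_vec m \<and> A *\<^sub>v v = 0\<^sub>v n"
  by (auto simp: mat_kernel_def)

text \<open>Rank-nullity in multiplicative form: each fibre of \<open>A\<close> over its range is a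
  translate of the kernel.\<close>

lemma card_mat_kernel_mult_rank:
  fixes A :: "'a::{field,finite} mat"
  assumes A: "A \<in> carrier_mat n m"
  shows "card (mat_kernel A) * CARD('a) ^ vec_space.rank n A = CARD('a) ^ m"
proof -
  have "card {x \<in> carrier_vec m. A *\<^sub>v x = z} = card (mat_kernel A)"
    if "z \<in> (*\<^sub>v) A ` carrier_vec m" for z
  proof -
    obtain u where u: "u \<in> carrier_vec m" "z = A *\<^sub>v u" using \<open>z \<in> _\<close> by auto
    have "bij_betw (\<lambda>x. x + u) (mat_kernel A) {x \<in> carrier_vec m. A *\<^sub>v x = z}"
    proof (rule bij_betwI[where g = "\<lambda>x. x - u"])
      show "(\<lambda>x. x + u) \<in> mat_kernel A \<rightarrow> {x \<in> carrier_vec m. A *\<^sub>v x = z}"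
        using u A by (auto simp: mat_kernel_iff mult_add_distrib_mat_vec[OF A])
      show "(\<lambda>x. x - u) \<in> {x \<in> carrier_vec m. A *\<^sub>v x = z} \<rightarrow> mat_kernel A"
        using u A by (auto simp: mat_kernel_iff mult_minus_distrib_mat_vec[OF A])
    qed (use u A in \<open>auto simp: mat_kernel_iff\<close>)
    then show ?thesis by (rule bij_betw_same_card[symmetric])
  qed
  from card_eq_card_image_mult[where f = "(*\<^sub>v) A", OF _ this] show ?thesis
    by (simp add: card_range_mult_mat_vec[OF A] card_carrier_vec mult.commute)
qed

section \<open>Subspaces and orthogonal complements\<close>

definition lin_subspace :: "nat \<Rightarrow> 'a::field vec set \<Rightarrow> bool" where
  "lin_subspace m W \<longleftrightarrow> W \<subseteq> carrier_vec m \<and> 0\<^sub>v m \<in> W \<and> (\<forall>v\<in>W. \<forall>w\<in>W. v + w \<in> W)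
     \<and> (\<forall>c. \<forall>v\<in>W. c \<cdot>\<^sub>v v \<in> W)"

text \<open>The complement for the standard bilinear form. Isotropic vectors may occur, so it can
  meet \<open>W\<close> outside zero; sizes are therefore compared by counting.\<close>

definition perp :: "nat \<Rightarrow> 'a::field vec set \<Rightarrow> 'a vec set" where
  "perp m W = {y \<in> carrier_vec m. \<forall>v\<in>W. y \<bullet> v = 0}"

lemma lin_subspace_carrier: "lin_subspace m (carrier_vec m)"
  by (simp add: lin_subspace_def)

lemma lin_subspace_mat_kernel:
  assumes A: "A \<in> carrier_mat n m"
  shows "lin_subspace m (mat_kernel A)"
proof -
  have "A *\<^sub>v 0\<^sub>v m = 0\<^sub>v n" by (rule eq_vecI) (use A in auto)
  moreover have "c \<cdot>\<^sub>v 0\<^sub>v n = (0\<^sub>v n :: 'a vec)" for c :: 'a by (rule eq_vecI) auto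
  ultimately show ?thesis
    by (simp add: lin_subspace_def subset_iff mat_kernel_iff[OF A]
        mult_add_distrib_mat_vec[OF A] mult_mat_vec[OF A])
qed

lemma lin_subspace_perp: "W \<subseteq> carrier_vec m \<Longrightarrow> lin_subspace m (perp m W)"
  unfolding lin_subspace_def
  by (intro conjI ballI allI subsetI)
    (auto simp: perp_def subset_iff add_scalar_prod_distrib[where n = m])

lemma finite_subspace: "W \<subseteq> carrier_vec m \<Longrightarrow> finite (W :: 'a::finite vec set)"
  by (rule finite_subset[OF _ finite_carrier_vec])

text \<open>A functional that is nonzero on \<open>W\<close> takes every value of the field, and its
  fibres are translates of each other along multiples of \<open>v0\<close>.\<close>

lemma card_functional_fibre:
  fixes W :: "'a::{field,finite} vec set"
  assumes W: "lin_subspace m W" and y: "y \<in> carrier_vec m" and v0: "v0 \<in> W" "y \<bullet> v0 \<noteq> 0"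
  shows "card {v \<in> W. y \<bullet> v = z} * CARD('a) = card W"
proof -
  have Wc: "W \<subseteq> carrier_vec m" using W by (simp add: lin_subspace_def)
  have f: "card {v \<in> W. y \<bullet> v = t} = card {v \<in> W. y \<bullet> v = z}" for t
  proof -
    \<comment> \<open>Scaled so that \<open>y \<bullet> u = t - z\<close>; translation by
      \<open>u\<close> then moves the fibre over \<open>z\<close> to the one over
      \<open>t\<close>.\<close>
    define u where "u = ((t - z) / (y \<bullet> v0)) \<cdot>\<^sub>v v0"
    have u: "u \<in> W" "-u \<in> W" "u \<in> carrier_vec m" "y \<bullet> u = t - z" "y \<bullet> (- u) = z - t"
    proof -
      show "u \<in> W" using W v0 by (auto simp: u_def lin_subspace_def)
      then have "(-1) \<cdot>\<^sub>v u \<in> W" using W by (auto simp: lin_subspace_def)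
      moreover have "(-1) \<cdot>\<^sub>v u = - u" by (intro eq_vecI) auto
      ultimately show "-u \<in> W" by simp
      show "u \<in> carrier_vec m" using \<open>u \<in> W\<close> Wc by auto
      have "v0 \<in> carrier_vec m" using v0 Wc by auto
      then show yu: "y \<bullet> u = t - z" using v0 y by (simp add: u_def)
      have "dim_vec y = dim_vec u" using y \<open>u \<in> carrier_vec m\<close> by simp
      then show "y \<bullet> (- u) = z - t" by (simp add: yu)
    qed
    have "bij_betw (\<lambda>v. v + u) {v \<in> W. y \<bullet> v = z} {v \<in> W. y \<bullet> v = t}"
    proof (rule bij_betwI[where g = "\<lambda>v. v + (-u)"])
      show "(\<lambda>v. v + u) \<in> {v \<in> W. y \<bullet> v = z} \<rightarrow> {v \<in> W. y \<bullet> v = t}"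
        using u W Wc y by (auto simp: lin_subspace_def scalar_prod_add_distrib[OF y] subset_iff)
      show "(\<lambda>v. v + (-u)) \<in> {v \<in> W. y \<bullet> v = t} \<rightarrow> {v \<in> W. y \<bullet> v = z}"
        using u(1-3) W Wc y
        by (auto simp: lin_subspace_def scalar_prod_add_distrib[OF y] subset_iff u(5)
            simp del: scalar_prod_uminus_right)
    qed (use Wc in \<open>auto simp: subset_iff vec_add_cancel[OF _ u(3)]\<close>)
    then show ?thesis by (rule bij_betw_same_card[symmetric])
  qed
  have img: "(\<bullet>) y ` W = UNIV"
  proof -
    have "t \<in> (\<bullet>) y ` W" for t
    proof (rule image_eqI)
      show "(t / (y \<bullet> v0)) \<cdot>\<^sub>v v0 \<in> W" using W v0 by (auto simp: lin_subspace_def)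
      have "v0 \<in> carrier_vec m" using v0 Wc by auto
      then show "t = y \<bullet> ((t / (y \<bullet> v0)) \<cdot>\<^sub>v v0)" using v0 y by simp
    qed
    then show ?thesis by blast
  qed
  show ?thesis
    using card_eq_card_image_mult[OF finite_subspace[OF Wc], OF f]
    by (simp add: img mult.commute)
qed

text \<open>The dimension formula in multiplicative form. In the double count, a nonzero
  \<open>v\<close> is orthogonal to one \<open>Q\<close>-th of all vectors, and a \<open>y\<close>
  outside the complement is orthogonal to one \<open>Q\<close>-th of \<open>W\<close>.\<close>

lemma card_mult_card_perp:
  fixes W :: "'a::{field,finite} vec set"
  assumes W: "lin_subspace m W"
  shows "card W * card (perp m W) = CARD('a) ^ m"
proof -
  have Wc: "W \<subseteq> carrier_vec m" and W0: "0\<^sub>v m \<in> W" using W by (auto simp: lin_subspace_def)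
  have fW: "finite W" using Wc by (rule finite_subspace)
  define V :: "'a vec set" where "V = carrier_vec m"
  have fV: "finite V" and cV: "card V = CARD('a) ^ m" by (auto simp: V_def card_carrier_vec)
  define Q where "Q = CARD('a)"
  have "Q \<ge> 2" unfolding Q_def by (rule card_field_ge_2)
  have P: "perp m W \<subseteq> V" by (auto simp: V_def perp_def)
  \<comment> \<open>Count the pairs \<open>(v, y)\<close> in \<open>W \<times> V\<close> with \<open>y \<bullet> v = 0\<close> in two ways.\<close>
  have swap: "(\<Sum>v\<in>W. card {y \<in> V. y \<bullet> v = 0}) = (\<Sum>y\<in>V. card {v \<in> W. y \<bullet> v = 0})"
    using sum.swap_restrict[OF fW fV, of "\<lambda>_ _. 1::nat" "\<lambda>v y. y \<bullet> v = 0"] by simp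
  have v: "Q * card {y \<in> V. y \<bullet> v = 0} = Q ^ m" if vW: "v \<in> W" "v \<noteq> 0\<^sub>v m" for v
  proof -
    have vc: "v \<in> carrier_vec m" using vW Wc by auto
    then have "\<exists>i<m. v $ i \<noteq> 0"
      using vW(2) eq_vecI[of v "0\<^sub>v m"] by auto
    then obtain i where i: "i < m" "v $ i \<noteq> 0" by blast
    then have "v \<bullet> unit_vec m i \<noteq> 0" using vc by simp
    from card_functional_fibre[OF lin_subspace_carrier vc _ this, of 0]
    have "card {y \<in> V. v \<bullet> y = 0} * Q = card V" by (simp add: V_def Q_def)
    moreover have "{y \<in> V. v \<bullet> y = 0} = {y \<in> V. y \<bullet> v = 0}"
      using comm_scalar_prod[OF vc] by (auto simp: V_def)
    ultimately show ?thesis by (simp add: cV Q_def mult.commute)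
  qed
  have y: "Q * card {v \<in> W. y \<bullet> v = 0} = (if y \<in> perp m W then Q else 1) * card W"
    if yV: "y \<in> V" for y
  proof (cases "y \<in> perp m W")
    case True
    then have "{v \<in> W. y \<bullet> v = 0} = W" by (auto simp: perp_def)
    then show ?thesis using True by simp
  next
    case False
    then obtain v0 where "v0 \<in> W" "y \<bullet> v0 \<noteq> 0" using yV by (auto simp: perp_def V_def)
    from card_functional_fibre[OF W _ this, of 0] yV False show ?thesis
      by (simp add: V_def Q_def mult.commute)
  qed
  \<comment> \<open>The factor \<open>Q\<close> avoids division. The zero vector is orthogonal to
    everything and is split off.\<close>
  have "Q * (\<Sum>v\<in>W. card {y \<in> V. y \<bullet> v = 0}) = Q * Q ^ m + (card W - 1) * Q ^ m"
  proof -
    have "{y \<in> V. y \<bullet> 0\<^sub>v m = 0} = V" by (auto simp: V_def)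
    then have "Q * (\<Sum>v\<in>W. card {y \<in> V. y \<bullet> v = 0}) =
        Q * Q ^ m + (\<Sum>v\<in>W - {0\<^sub>v m}. Q * card {y \<in> V. y \<bullet> v = 0})"
      by (simp add: sum.remove[OF fW W0] cV Q_def sum_distrib_left distrib_left)
    also have "(\<Sum>v\<in>W - {0\<^sub>v m}. Q * card {y \<in> V. y \<bullet> v = 0}) = (card W - 1) * Q ^ m"
      using v fW W0 by simp
    finally show ?thesis .
  qed
  moreover have "Q * (\<Sum>y\<in>V. card {v \<in> W. y \<bullet> v = 0}) =
      Q * (card (perp m W) * card W) + (Q ^ m - card (perp m W)) * card W"
  proof -
    have "(\<Sum>y\<in>V. (if y \<in> perp m W then Q else 1) * card W) =
      (\<Sum>y\<in>perp m W. Q * card W) + (\<Sum>y\<in>V - perp m W. card W)"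
      using P fV by (subst sum.subset_diff[OF P fV]) simp
    then show ?thesis
      using y P fV by (simp add: sum_distrib_left card_Diff_subset finite_subset[OF P fV] cV Q_def)
  qed
  ultimately have eq: "Q * Q ^ m + (card W - 1) * Q ^ m =
      Q * (card (perp m W) * card W) + (Q ^ m - card (perp m W)) * card W"
    using swap by simp
  \<comment> \<open>The bounds make the natural subtractions exact, so that the identity can be
    moved to the integers, where it factors.\<close>
  have "card (perp m W) \<le> Q ^ m" using card_mono[OF fV P] cV by (simp add: Q_def)
  moreover have "card W \<ge> 1" using W0 fW by (metis One_nat_def Suc_leI card_gt_0_iff empty_iff)
  ultimately have "int (card W - 1) = int (card W) - 1"
    "int (Q ^ m - card (perp m W)) = int (Q ^ m) - int (card (perp m W))"
    by (simp_all only: of_nat_diff of_nat_1)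
  then have "int Q * int (Q ^ m) + (int (card W) - 1) * int (Q ^ m) =
      int Q * (int (card (perp m W)) * int (card W)) + (int (Q ^ m) - int (card (perp m W))) * int (card W)"
    using arg_cong[OF eq, of int] by (simp only: of_nat_add of_nat_mult)
  then have "(int Q - 1) * (int (card W) * int (card (perp m W)) - int (Q ^ m)) = 0"
    by (simp only: algebra_simps)
  then have "int (card W * card (perp m W)) = int (Q ^ m)" using \<open>Q \<ge> 2\<close> by simp
  then show ?thesis by (simp only: of_nat_eq_iff Q_def)
qed

text \<open>One inclusion is symmetry of the scalar product; the dimension formula, applied twice,
  shows that the sizes agree.\<close>

lemma perp_perp:
  fixes W :: "'a::{field,finite} vec set"
  assumes W: "lin_subspace m W"
  shows "perp m (perp m W) = W"
proof (rule card_seteq[symmetric])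
  have Wc: "W \<subseteq> carrier_vec m" using W by (auto simp: lin_subspace_def)
  have Pc: "perp m W \<subseteq> carrier_vec m" by (auto simp: perp_def)
  show "finite (perp m (perp m W))" by (rule finite_subspace[of _ m]) (auto simp: perp_def)
  show "W \<subseteq> perp m (perp m W)"
    using Wc comm_scalar_prod by (fastforce simp: perp_def)
  have "card (perp m W) * card (perp m (perp m W)) = card (perp m W) * card W"
    using card_mult_card_perp[OF W] card_mult_card_perp[OF lin_subspace_perp[OF Wc]]
    by (simp add: mult.commute)
  moreover have "card (perp m W) \<noteq> 0"
    using card_mult_card_perp[OF W] by (metis mult_0_right power_eq_0_iff zero_less_card_finite less_numeral_extra(3))
  ultimately show "card (perp m (perp m W)) \<le> card W" by simp
qed

subsection \<open>Rank-one perturbations\<close>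

text \<open>The matrix x y^T. A nonzero matrix of this form comes from several pairs; the counts
  below are of pairs, not of matrices.\<close>

definition outer :: "'a::times vec \<Rightarrow> 'a vec \<Rightarrow> 'a mat" where
  "outer x y = mat (dim_vec x) (dim_vec y) (\<lambda>(i, j). x $ i * y $ j)"

lemma outer_carrier [simp]:
  "x \<in> carrier_vec n \<Longrightarrow> y \<in> carrier_vec m \<Longrightarrow> outer x y \<in> carrier_mat n m"
  by (auto simp: outer_def)

lemma outer_mult_vec:
  fixes x :: "'a::comm_ring_1 vec"
  assumes "x \<in> carrier_vec n" "y \<in> carrier_vec m" "v \<in> carrier_vec m"
  shows "outer x y *\<^sub>v v = (y \<bullet> v) \<cdot>\<^sub>v x"
  using assms
  by (intro eq_vecI) (auto simp: outer_def scalar_prod_def sum_distrib_left sum_distrib_right ac_simps)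

section \<open>Kernels of rank-one perturbations\<close>

lemma mat_kernel_add_outer:
  fixes c :: "'a::field mat"
  assumes c: "c \<in> carrier_mat n m" and x: "x \<in> carrier_vec n" and y: "y \<in> carrier_vec m"
  shows "v \<in> mat_kernel (c + outer x y) \<longleftrightarrow>
    v \<in> carrier_vec m \<and> c *\<^sub>v v + (y \<bullet> v) \<cdot>\<^sub>v x = 0\<^sub>v n"
proof -
  have "c + outer x y \<in> carrier_mat n m" using assms by simp
  then show ?thesis
    using add_mult_distrib_mat_vec[OF c outer_carrier[OF x y], of v] outer_mult_vec[OF x y, of v]
    by (auto simp: mat_kernel_iff)
qed

text \<open>If \<open>y \<bullet> v\<close> were nonzero, the kernel equation could be solved for
  \<open>x\<close>, which would put \<open>x\<close> in the range of \<open>c\<close>.\<close>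

lemma mat_kernel_add_outer_not_range:
  fixes c :: "'a::field mat"
  assumes c: "c \<in> carrier_mat n m" and x: "x \<in> carrier_vec n" and y: "y \<in> carrier_vec m"
    and nx: "x \<notin> (*\<^sub>v) c ` carrier_vec m"
  shows "mat_kernel (c + outer x y) = {v \<in> mat_kernel c. y \<bullet> v = 0}"
proof -
  have "y \<bullet> v = 0" if v: "v \<in> carrier_vec m" and eq: "c *\<^sub>v v + (y \<bullet> v) \<cdot>\<^sub>v x = 0\<^sub>v n" for v
  proof (rule ccontr)
    assume n0: "y \<bullet> v \<noteq> 0"
    have cv: "c *\<^sub>v v \<in> carrier_vec n" using c v by simp
    have "c *\<^sub>v ((- 1 / (y \<bullet> v)) \<cdot>\<^sub>v v) = (- 1 / (y \<bullet> v)) \<cdot>\<^sub>v (c *\<^sub>v v)"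
      by (rule mult_mat_vec[OF c v])
    also have "\<dots> = x"
    proof (rule eq_vecI)
      fix i assume "i < dim_vec x"
      then have i: "i < n" using x by simp
      have "(c *\<^sub>v v + (y \<bullet> v) \<cdot>\<^sub>v x) $ i = 0" using i by (simp add: eq)
      moreover have "(c *\<^sub>v v + (y \<bullet> v) \<cdot>\<^sub>v x) $ i = (c *\<^sub>v v) $ i + (y \<bullet> v) * x $ i"
        using i cv x by (simp del: index_mult_mat_vec)
      ultimately have "(c *\<^sub>v v) $ i = - (y \<bullet> v) * x $ i" by (simp add: eq_neg_iff_add_eq_0)
      moreover have "((- 1 / (y \<bullet> v)) \<cdot>\<^sub>v (c *\<^sub>v v)) $ i = (- 1 / (y \<bullet> v)) * (c *\<^sub>v v) $ i"
        by (rule index_smult_vec) (use i c in simp)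
      ultimately show "((- 1 / (y \<bullet> v)) \<cdot>\<^sub>v (c *\<^sub>v v)) $ i = x $ i"
        using n0 by simp
    qed (use c x in auto)
    finally have "x = c *\<^sub>v ((- 1 / (y \<bullet> v)) \<cdot>\<^sub>v v)" ..
    then have "x \<in> (*\<^sub>v) c ` carrier_vec m" by (rule image_eqI) (use v in simp)
    then show False using nx by contradiction
  qed
  moreover have "0 \<cdot>\<^sub>v x = 0\<^sub>v n" using x by (intro eq_vecI) auto
  moreover have "c *\<^sub>v v + 0\<^sub>v n = c *\<^sub>v v" if "v \<in> carrier_vec m" for v
    by (rule right_zero_vec) (use c that in simp)
  ultimately have "v \<in> mat_kernel (c + outer x y) \<longleftrightarrow> v \<in> {v \<in> mat_kernel c. y \<bullet> v = 0}" for v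
    unfolding mat_kernel_add_outer[OF c x y] mem_Collect_eq mat_kernel_iff[OF c] by metis
  then show ?thesis by blast
qed

text \<open>With \<open>x = c *\<^sub>v u\<close> the perturbation can be pulled inside
  \<open>c\<close>, since \<open>c\<close> is linear.\<close>

lemma mat_kernel_add_outer_range:
  fixes c :: "'a::field mat"
  assumes c: "c \<in> carrier_mat n m" and u: "u \<in> carrier_vec m" and y: "y \<in> carrier_vec m"
  shows "v \<in> mat_kernel (c + outer (c *\<^sub>v u) y) \<longleftrightarrow>
    v \<in> carrier_vec m \<and> v + (y \<bullet> v) \<cdot>\<^sub>v u \<in> mat_kernel c"
proof -
  have "c *\<^sub>v (v + (y \<bullet> v) \<cdot>\<^sub>v u) = c *\<^sub>v v + (y \<bullet> v) \<cdot>\<^sub>v (c *\<^sub>v u)"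
    if "v \<in> carrier_vec m"
    using mult_add_distrib_mat_vec[OF c that, of "(y \<bullet> v) \<cdot>\<^sub>v u"] mult_mat_vec[OF c u] u by simp
  then show ?thesis
    using u mult_mat_vec_carrier[OF c u] by (auto simp: mat_kernel_add_outer[OF c _ y] mat_kernel_iff[OF c])
qed

text \<open>Since \<open>y\<close> vanishes on the old kernel and
  \<open>y \<bullet> u = - 1\<close>, the vectors \<open>v\<close> of the new kernel with
  \<open>y \<bullet> v = t\<close> are the old kernel translated by
  \<open>- t \<cdot>\<^sub>v u\<close>. There is one such slice for each \<open>t\<close> in the
  field.\<close>

lemma card_mat_kernel_outer_range_perp:
  fixes c :: "'a::{field,finite} mat"
  assumes c: "c \<in> carrier_mat n m" and u: "u \<in> carrier_vec m"
    and y: "y \<in> perp m (mat_kernel c)" and yu: "y \<bullet> u = - 1"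
  shows "card (mat_kernel (c + outer (c *\<^sub>v u) y)) = CARD('a) * card (mat_kernel c)"
proof -
  let ?K = "mat_kernel c" and ?L = "mat_kernel (c + outer (c *\<^sub>v u) y)"
  have y0: "y \<bullet> w = 0" if "w \<in> ?K" for w
    using y that by (auto simp: perp_def)
  have yc: "y \<in> carrier_vec m" using y by (auto simp: perp_def)
  have Kc: "w \<in> carrier_vec m" if "w \<in> ?K" for w using that by (simp add: mat_kernel_iff[OF c])
  note L = mat_kernel_add_outer_range[OF c u yc]
  have bij: "bij_betw (\<lambda>w. w + (- t) \<cdot>\<^sub>v u) ?K {v \<in> ?L. y \<bullet> v = t}" for t
  proof (rule bij_betwI[where g = "\<lambda>v. v + t \<cdot>\<^sub>v u"])
    have canc: "w + (- t) \<cdot>\<^sub>v u + t \<cdot>\<^sub>v u = w" "w + t \<cdot>\<^sub>v u + (- t) \<cdot>\<^sub>v u = w"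
      if "w \<in> carrier_vec m" for w
      using that u by - (rule eq_vecI; simp)+
    have yw: "y \<bullet> (w + (- t) \<cdot>\<^sub>v u) = t" if "w \<in> ?K" for w
      using scalar_prod_add_distrib[OF yc Kc[OF that], of "(- t) \<cdot>\<^sub>v u"] u y0[OF that] yu yc by simp
    show "(\<lambda>w. w + (- t) \<cdot>\<^sub>v u) \<in> ?K \<rightarrow> {v \<in> ?L. y \<bullet> v = t}"
      using Kc u by (simp add: L yw canc Pi_iff)
    show "(\<lambda>v. v + t \<cdot>\<^sub>v u) \<in> {v \<in> ?L. y \<bullet> v = t} \<rightarrow> ?K"
      by (auto simp: L)
    show "w + (- t) \<cdot>\<^sub>v u + t \<cdot>\<^sub>v u = w" if "w \<in> ?K" for w by (rule canc(1)[OF Kc[OF that]])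
    show "w + t \<cdot>\<^sub>v u + (- t) \<cdot>\<^sub>v u = w" if "w \<in> {v \<in> ?L. y \<bullet> v = t}" for w
      by (rule canc(2)) (use that L in blast)
  qed
  have "0\<^sub>v m \<in> ?K" using lin_subspace_mat_kernel[OF c] by (simp add: lin_subspace_def)
  then have "t \<in> (\<bullet>) y ` ?L" for t
    using bij_betw_apply[OF bij[of t]] by force
  then have "(\<bullet>) y ` ?L = UNIV" by blast
  moreover have "finite ?L" by (rule finite_subspace[of _ m]) (use L in blast)
  ultimately show ?thesis
    using card_eq_card_image_mult[of ?L "(\<bullet>) y", OF _ bij_betw_same_card[OF bij, symmetric]] by simp
qed

text \<open>Applying \<open>y\<close> to \<open>v + (y \<bullet> v) \<cdot>\<^sub>v u\<close> gives
  \<open>(y \<bullet> v) * (1 + y \<bullet> u) = 0\<close>, which forces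
  \<open>y \<bullet> v = 0\<close>.\<close>

lemma mat_kernel_outer_range_perp_other:
  fixes c :: "'a::{field,finite} mat"
  assumes c: "c \<in> carrier_mat n m" and u: "u \<in> carrier_vec m"
    and y: "y \<in> perp m (mat_kernel c)" and yu: "y \<bullet> u \<noteq> - 1"
  shows "mat_kernel (c + outer (c *\<^sub>v u) y) = mat_kernel c"
proof -
  have yc: "y \<in> carrier_vec m" using y by (auto simp: perp_def)
  have y0: "y \<bullet> w = 0" if "w \<in> mat_kernel c" for w using y that by (auto simp: perp_def)
  have u0: "0 \<cdot>\<^sub>v u = 0\<^sub>v m" using u by (intro eq_vecI) auto
  note L = mat_kernel_add_outer_range[OF c u yc]
  have "v \<in> mat_kernel c" if v: "v \<in> carrier_vec m" "v + (y \<bullet> v) \<cdot>\<^sub>v u \<in> mat_kernel c" for v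
  proof -
    have "y \<bullet> (v + (y \<bullet> v) \<cdot>\<^sub>v u) = (y \<bullet> v) * (1 + y \<bullet> u)"
      using scalar_prod_add_distrib[OF yc v(1), of "(y \<bullet> v) \<cdot>\<^sub>v u"] u yc by (simp add: algebra_simps)
    then have "(y \<bullet> v) * (1 + y \<bullet> u) = 0" using y0[OF v(2)] by simp
    moreover have "1 + y \<bullet> u \<noteq> 0" using yu by (metis add.commute eq_neg_iff_add_eq_0)
    ultimately have "y \<bullet> v = 0" by simp
    then show ?thesis using v u0 by simp
  qed
  moreover have "v \<in> carrier_vec m \<and> v + (y \<bullet> v) \<cdot>\<^sub>v u \<in> mat_kernel c" if "v \<in> mat_kernel c" for v
    using that y0[OF that] u0 by (simp add: mat_kernel_iff[OF c])
  ultimately show ?thesis using L by blast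
qed

lemma card_mat_kernel_outer_range_not_perp:
  fixes c :: "'a::{field,finite} mat"
  assumes c: "c \<in> carrier_mat n m" and u: "u \<in> carrier_vec m" and y: "y \<in> carrier_vec m"
    and ny: "y \<notin> perp m (mat_kernel c)"
  shows "card (mat_kernel (c + outer (c *\<^sub>v u) y)) = card (mat_kernel c)"
proof -
  let ?K = "mat_kernel c"
  obtain w0 where w0: "w0 \<in> ?K" "y \<bullet> w0 \<noteq> 0" using ny y by (auto simp: perp_def)
  then have w0c: "w0 \<in> carrier_vec m" "c *\<^sub>v w0 = 0\<^sub>v n" by (auto simp: mat_kernel_iff[OF c])
  \<comment> \<open>Among the preimages of \<open>c *\<^sub>v u\<close> choose \<open>u'\<close> with \<open>y \<bullet> u' = 0\<close>: then \<open>v \<mapsto> v + (y \<bullet> v) \<cdot>\<^sub>v u'\<close> is invertible.\<close>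
  define a where "a = - (y \<bullet> u) / (y \<bullet> w0)"
  define u' where "u' = u + a \<cdot>\<^sub>v w0"
  have u': "u' \<in> carrier_vec m" using u w0c by (simp add: u'_def)
  have "a \<cdot>\<^sub>v 0\<^sub>v n = (0\<^sub>v n :: 'a vec)" by (rule eq_vecI) auto
  then have cu': "c *\<^sub>v u' = c *\<^sub>v u"
    using mult_add_distrib_mat_vec[OF c u, of "a \<cdot>\<^sub>v w0"] mult_mat_vec[OF c w0c(1)] w0c
      mult_mat_vec_carrier[OF c u] by (simp add: u'_def)
  have yu': "y \<bullet> u' = 0"
    using scalar_prod_add_distrib[OF y u, of "a \<cdot>\<^sub>v w0"] w0 w0c y by (simp add: u'_def a_def)
  have Kc: "w \<in> carrier_vec m" if "w \<in> ?K" for w using that by (simp add: mat_kernel_iff[OF c])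
  note L = mat_kernel_add_outer_range[OF c u' y, unfolded cu']
  have yv: "y \<bullet> (v + b \<cdot>\<^sub>v u') = y \<bullet> v" if "v \<in> carrier_vec m" for v b
    using scalar_prod_add_distrib[OF y that, of "b \<cdot>\<^sub>v u'"] u' yu' y by simp
  have canc: "w + (- t) \<cdot>\<^sub>v u' + t \<cdot>\<^sub>v u' = w" "w + t \<cdot>\<^sub>v u' + (- t) \<cdot>\<^sub>v u' = w"
    if "w \<in> carrier_vec m" for w t
    using that u' by - (rule eq_vecI; simp)+
  have "bij_betw (\<lambda>w. w + (- (y \<bullet> w)) \<cdot>\<^sub>v u') ?K (mat_kernel (c + outer (c *\<^sub>v u) y))"
  proof (rule bij_betwI[where g = "\<lambda>v. v + (y \<bullet> v) \<cdot>\<^sub>v u'"])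
    show "(\<lambda>w. w + (- (y \<bullet> w)) \<cdot>\<^sub>v u') \<in> ?K \<rightarrow> mat_kernel (c + outer (c *\<^sub>v u) y)"
      using Kc u' by (simp add: L yv canc Pi_iff)
    show "(\<lambda>v. v + (y \<bullet> v) \<cdot>\<^sub>v u') \<in> mat_kernel (c + outer (c *\<^sub>v u) y) \<rightarrow> ?K"
      by (auto simp: L)
    show "w + (- (y \<bullet> w)) \<cdot>\<^sub>v u' + (y \<bullet> (w + (- (y \<bullet> w)) \<cdot>\<^sub>v u')) \<cdot>\<^sub>v u' = w"
      if "w \<in> ?K" for w
      using Kc[OF that] by (simp only: yv canc)
    show "v + (y \<bullet> v) \<cdot>\<^sub>v u' + (- (y \<bullet> (v + (y \<bullet> v) \<cdot>\<^sub>v u'))) \<cdot>\<^sub>v u' = v"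
      if "v \<in> mat_kernel (c + outer (c *\<^sub>v u) y)" for v
    proof -
      have "v \<in> carrier_vec m" using that L by blast
      then show ?thesis by (simp only: yv canc)
    qed
  qed
  then show ?thesis by (rule bij_betw_same_card[symmetric])
qed

text \<open>Translates a comparison of kernel sizes into one of ranks. Exponents on both sides avoid
  subtraction.\<close>

lemma rank_eq_of_card_mat_kernel:
  fixes c d :: "'a::{field,finite} mat"
  assumes c: "c \<in> carrier_mat n m" and d: "d \<in> carrier_mat n m"
    and eq: "card (mat_kernel c) * CARD('a) ^ i = card (mat_kernel d) * CARD('a) ^ j"
  shows "vec_space.rank n d + i = vec_space.rank n c + j"
proof -
  let ?Q = "CARD('a)"
  have "?Q ^ m * ?Q ^ (vec_space.rank n d + i)
      = (card (mat_kernel c) * ?Q ^ i) * ?Q ^ vec_space.rank n c * ?Q ^ vec_space.rank n d"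
    by (simp add: power_add ac_simps flip: card_mat_kernel_mult_rank[OF c])
  also have "\<dots> = (card (mat_kernel d) * ?Q ^ vec_space.rank n d) * ?Q ^ (vec_space.rank n c + j)"
    by (simp add: eq power_add ac_simps)
  finally have "?Q ^ (vec_space.rank n d + i) = ?Q ^ (vec_space.rank n c + j)"
    by (simp add: card_mat_kernel_mult_rank[OF d])
  then show ?thesis using card_field_ge_2[where ?'a = 'a] by simp
qed

text \<open>Here \<open>r\<close> and \<open>r'\<close> are the ranks before and after a
  perturbation; \<open>A\<close> is the condition for a rise and \<open>D\<close> the one for a
  drop.\<close>

lemma nat_trichotomy_cases:
  fixes r r' :: nat
  assumes "A \<and> r' = Suc r \<and> \<not> D \<or> \<not> A \<and> r' = r \<and> \<not> D \<or> \<not> A \<and> Suc r' = r \<and> D"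
  shows "r' = Suc r \<longleftrightarrow> A" "Suc r' = r \<longleftrightarrow> D" "r' \<in> {r, Suc r, r - 1}"
  using assms by auto

section \<open>Rank changes under rank-one perturbations, and their number\<close>

context
  fixes c :: "'a::{field,finite} mat" and n m :: nat
  assumes c: "c \<in> carrier_mat n m"
begin

lemma rank_add_outer_not_range_not_perp:
  assumes x: "x \<in> carrier_vec n" and y: "y \<in> carrier_vec m"
    and "x \<notin> (*\<^sub>v) c ` carrier_vec m" and "y \<notin> perp m (mat_kernel c)"
  shows "vec_space.rank n (c + outer x y) = Suc (vec_space.rank n c)"
proof -
  obtain v0 where v0: "v0 \<in> mat_kernel c" "y \<bullet> v0 \<noteq> 0" using assms by (auto simp: perp_def)
  from card_functional_fibre[OF lin_subspace_mat_kernel[OF c] y v0, of 0]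
  have "card (mat_kernel c) * CARD('a) ^ 0 = card (mat_kernel (c + outer x y)) * CARD('a) ^ 1"
    by (simp add: mat_kernel_add_outer_not_range[OF c x y assms(3)])
  from rank_eq_of_card_mat_kernel[OF c _ this] c x y show ?thesis by simp
qed

lemma rank_add_outer_not_range_perp:
  assumes x: "x \<in> carrier_vec n"
    and nx: "x \<notin> (*\<^sub>v) c ` carrier_vec m" and y: "y \<in> perp m (mat_kernel c)"
  shows "vec_space.rank n (c + outer x y) = vec_space.rank n c"
proof -
  have yc: "y \<in> carrier_vec m" using y by (simp add: perp_def)
  have "\<forall>v\<in>mat_kernel c. y \<bullet> v = 0" using y by (simp add: perp_def)
  then have "mat_kernel (c + outer x y) = mat_kernel c"
    unfolding mat_kernel_add_outer_not_range[OF c x yc nx] by blast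
  then show ?thesis using rank_eq_of_card_mat_kernel[OF c, of "c + outer x y" 0 0] c x yc by simp
qed

lemma rank_add_outer_range_not_perp:
  assumes u: "u \<in> carrier_vec m" and y: "y \<in> carrier_vec m" and "y \<notin> perp m (mat_kernel c)"
  shows "vec_space.rank n (c + outer (c *\<^sub>v u) y) = vec_space.rank n c"
  using card_mat_kernel_outer_range_not_perp[OF c assms]
    rank_eq_of_card_mat_kernel[OF c, of "c + outer (c *\<^sub>v u) y" 0 0] c u y
    mult_mat_vec_carrier[OF c u] by simp

lemma rank_add_outer_range_perp_other:
  assumes u: "u \<in> carrier_vec m" and y: "y \<in> perp m (mat_kernel c)" and "y \<bullet> u \<noteq> - 1"
  shows "vec_space.rank n (c + outer (c *\<^sub>v u) y) = vec_space.rank n c"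
proof -
  have "y \<in> carrier_vec m" using y by (simp add: perp_def)
  then show ?thesis
    using mat_kernel_outer_range_perp_other[OF c assms]
      rank_eq_of_card_mat_kernel[OF c, of "c + outer (c *\<^sub>v u) y" 0 0] c u
      mult_mat_vec_carrier[OF c u] by simp
qed

lemma rank_add_outer_range_perp:
  assumes u: "u \<in> carrier_vec m" and y: "y \<in> perp m (mat_kernel c)" and "y \<bullet> u = - 1"
  shows "Suc (vec_space.rank n (c + outer (c *\<^sub>v u) y)) = vec_space.rank n c"
proof -
  have "y \<in> carrier_vec m" using y by (simp add: perp_def)
  then show ?thesis
    using card_mat_kernel_outer_range_perp[OF c assms]
      rank_eq_of_card_mat_kernel[OF c, of "c + outer (c *\<^sub>v u) y" 1 0] c u
      mult_mat_vec_carrier[OF c u] by (simp add: mult.commute)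
qed

text \<open>The set \<open>perp m (mat_kernel c)\<close> is the row space of \<open>c\<close>. The
  rank rises when both \<open>x\<close> and \<open>y\<close> leave their spaces; it can drop only
  when both stay inside, and then precisely if \<open>y \<bullet> u = - 1\<close> for a preimage
  \<open>u\<close> of \<open>x\<close>.\<close>

lemma rank_add_outer_cases:
  assumes x: "x \<in> carrier_vec n" and y: "y \<in> carrier_vec m"
  shows "vec_space.rank n (c + outer x y) = Suc (vec_space.rank n c) \<longleftrightarrow>
      x \<notin> (*\<^sub>v) c ` carrier_vec m \<and> y \<notin> perp m (mat_kernel c)" (is ?A)
    and "Suc (vec_space.rank n (c + outer x y)) = vec_space.rank n c \<longleftrightarrow>
      (\<exists>u\<in>carrier_vec m. x = c *\<^sub>v u \<and> y \<in> perp m (mat_kernel c) \<and> y \<bullet> u = - 1)" (is ?B)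
    and "vec_space.rank n (c + outer x y)
      \<in> {vec_space.rank n c, Suc (vec_space.rank n c), vec_space.rank n c - 1}" (is ?C)
proof -
  let ?r = "vec_space.rank n c" and ?r' = "vec_space.rank n (c + outer x y)"
  let ?R = "(*\<^sub>v) c ` carrier_vec m" and ?P = "perp m (mat_kernel c)"
  let ?D = "\<exists>u\<in>carrier_vec m. x = c *\<^sub>v u \<and> y \<in> ?P \<and> y \<bullet> u = - 1"
  have D: "Suc ?r' = ?r" if ?D using that rank_add_outer_range_perp by blast
  have "(x \<notin> ?R \<and> y \<notin> ?P) \<and> ?r' = Suc ?r \<and> \<not> ?D
    \<or> \<not> (x \<notin> ?R \<and> y \<notin> ?P) \<and> ?r' = ?r \<and> \<not> ?D
    \<or> \<not> (x \<notin> ?R \<and> y \<notin> ?P) \<and> Suc ?r' = ?r \<and> ?D"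
  proof (cases "x \<in> ?R")
    case False
    then have "\<not> ?D" by blast
    then show ?thesis
      using rank_add_outer_not_range_perp[OF x False]
        rank_add_outer_not_range_not_perp[OF x y False] False by blast
  next
    case True
    then obtain u where u: "u \<in> carrier_vec m" "x = c *\<^sub>v u" by blast
    show ?thesis
    proof (cases "y \<in> ?P \<and> y \<bullet> u = - 1")
      case T: True
      then have ?D using u by blast
      then show ?thesis using D True by blast
    next
      case False
      then have r: "?r' = ?r"
        using rank_add_outer_range_not_perp[OF u(1) y] rank_add_outer_range_perp_other[OF u(1), of y]
        unfolding u(2) by blast
      then have "\<not> ?D" using D by (metis n_not_Suc_n)
      then show ?thesis using True r by blast
    qed
  qed
  from nat_trichotomy_cases[OF this] show ?A ?B ?C .
qed

text \<open>Row rank equals column rank, obtained by comparing the dimension formula with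
  rank-nullity.\<close>

lemma card_perp_mat_kernel: "card (perp m (mat_kernel c)) = CARD('a) ^ vec_space.rank n c"
proof -
  have "card (mat_kernel c) * card (perp m (mat_kernel c))
      = card (mat_kernel c) * CARD('a) ^ vec_space.rank n c"
    using card_mult_card_perp[OF lin_subspace_mat_kernel[OF c]] card_mat_kernel_mult_rank[OF c] by simp
  moreover have "card (mat_kernel c) \<noteq> 0"
    using card_mat_kernel_mult_rank[OF c] card_field_ge_2[where ?'a = 'a]
    by (intro notI) simp
  ultimately show ?thesis by simp
qed

lemma card_rank_add_outer_up:
  "card {(x, y) \<in> carrier_vec n \<times> carrier_vec m.
      vec_space.rank n (c + outer x y) = Suc (vec_space.rank n c)}
   = (CARD('a) ^ n - CARD('a) ^ vec_space.rank n c) * (CARD('a) ^ m - CARD('a) ^ vec_space.rank n c)"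
proof -
  let ?R = "(*\<^sub>v) c ` carrier_vec m" and ?P = "perp m (mat_kernel c)"
  have "{(x, y) \<in> carrier_vec n \<times> carrier_vec m.
      vec_space.rank n (c + outer x y) = Suc (vec_space.rank n c)}
    = (carrier_vec n - ?R) \<times> (carrier_vec m - ?P)"
    using rank_add_outer_cases(1) by blast
  moreover have "?R \<subseteq> carrier_vec n" using mult_mat_vec_carrier[OF c] by blast
  moreover have "?P \<subseteq> carrier_vec m" by (auto simp: perp_def)
  ultimately show ?thesis
    by (simp add: card_cartesian_product card_Diff_subset finite_subset card_carrier_vec
        card_range_mult_mat_vec[OF c] card_perp_mat_kernel)
qed

text \<open>As the double complement of the kernel is the kernel itself, a vector \<open>u\<close>
  outside it is not orthogonal to the whole row space, so \<open>u\<close> induces a nonzero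
  functional there.\<close>

lemma card_perp_fibre:
  assumes u: "u \<in> carrier_vec m" and nz: "c *\<^sub>v u \<noteq> 0\<^sub>v n"
  shows "card {y \<in> perp m (mat_kernel c). y \<bullet> u = z} = CARD('a) ^ (vec_space.rank n c - 1)"
proof -
  let ?P = "perp m (mat_kernel c)" and ?r = "vec_space.rank n c"
  have Pc: "?P \<subseteq> carrier_vec m" by (auto simp: perp_def)
  have K: "mat_kernel c \<subseteq> carrier_vec m" using mat_kernel_iff[OF c] by blast
  have "u \<notin> perp m ?P"
    using nz by (simp add: perp_perp[OF lin_subspace_mat_kernel[OF c]] mat_kernel_iff[OF c])
  then obtain y0 where y0: "y0 \<in> ?P" "u \<bullet> y0 \<noteq> 0" using u unfolding perp_def[of m ?P] by blast
  have "{y \<in> ?P. y \<bullet> u = z} = {y \<in> ?P. u \<bullet> y = z}"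
    using comm_scalar_prod[OF u subsetD[OF Pc]] by (intro Collect_cong conj_cong refl) simp
  then have *: "card {y \<in> ?P. y \<bullet> u = z} * CARD('a) = CARD('a) ^ ?r"
    using card_functional_fibre[OF lin_subspace_perp[OF K] u y0, of z] card_perp_mat_kernel by simp
  \<comment> \<open>Ensures that the truncated exponent \<open>?r - 1\<close> is the true
    predecessor.\<close>
  have "?r \<noteq> 0"
  proof
    assume "?r = 0"
    then have "card {y \<in> ?P. y \<bullet> u = z} * CARD('a) = 1" using * by simp
    then show False using card_field_ge_2[where ?'a = 'a] by simp
  qed
  then have "CARD('a) ^ ?r = CARD('a) ^ (?r - 1) * CARD('a)" by (metis power_minus_mult neq0_conv)
  with * have "card {y \<in> ?P. y \<bullet> u = z} * CARD('a) = CARD('a) ^ (?r - 1) * CARD('a)" by simp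
  then show ?thesis using card_field_ge_2[where ?'a = 'a] by simp
qed

text \<open>Fibre the pairs over \<open>x\<close>: each nonzero \<open>x\<close> in the range admits
  the same number of \<open>y\<close>, namely a fibre of the functional given by a preimage of
  \<open>x\<close>.\<close>

lemma card_rank_add_outer_down:
  "card {(x, y) \<in> carrier_vec n \<times> carrier_vec m.
      Suc (vec_space.rank n (c + outer x y)) = vec_space.rank n c}
   = (CARD('a) ^ vec_space.rank n c - 1) * CARD('a) ^ (vec_space.rank n c - 1)"
proof -
  let ?R = "(*\<^sub>v) c ` carrier_vec m" and ?P = "perp m (mat_kernel c)"
  define pre where "pre x = (SOME u. u \<in> carrier_vec m \<and> x = c *\<^sub>v u)" for x
  have pre: "pre x \<in> carrier_vec m" "c *\<^sub>v pre x = x" if "x \<in> ?R" for x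
  proof -
    have "\<exists>u. u \<in> carrier_vec m \<and> x = c *\<^sub>v u" using that by blast
    from someI_ex[OF this] show "pre x \<in> carrier_vec m" "c *\<^sub>v pre x = x" unfolding pre_def by auto
  qed
  have Rc: "?R \<subseteq> carrier_vec n" using mult_mat_vec_carrier[OF c] by blast
  have fR: "finite ?R" by simp
  \<comment> \<open>Two preimages differ by a kernel element, which \<open>y\<close> annihilates; so
    the choice of \<open>pre\<close> does not affect the condition on \<open>y\<close>.\<close>
  have same: "y \<bullet> u = y \<bullet> pre (c *\<^sub>v u)" if u: "u \<in> carrier_vec m" and y: "y \<in> ?P" for u y
  proof -
    have p: "pre (c *\<^sub>v u) \<in> carrier_vec m" "c *\<^sub>v pre (c *\<^sub>v u) = c *\<^sub>v u" using pre u by blast+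
    have "u - pre (c *\<^sub>v u) \<in> mat_kernel c"
      using u p mult_mat_vec_carrier[OF c u] by (simp add: mat_kernel_iff[OF c] mult_minus_distrib_mat_vec[OF c])
    then have "y \<bullet> (u - pre (c *\<^sub>v u)) = 0" and "y \<in> carrier_vec m" using y by (auto simp: perp_def)
    then show ?thesis using scalar_prod_minus_distrib[of y m u "pre (c *\<^sub>v u)"] u p by simp
  qed
  \<comment> \<open>Excludes \<open>x = 0\<close>: its preimages lie in the kernel, where
    \<open>y\<close> takes the value 0 and not -1.\<close>
  have nz: "c *\<^sub>v u \<noteq> 0\<^sub>v n" if u: "u \<in> carrier_vec m" and y: "y \<in> ?P" "y \<bullet> u = - 1" for u y
  proof
    assume "c *\<^sub>v u = 0\<^sub>v n"
    then have "y \<bullet> u = 0" using u y by (auto simp: perp_def mat_kernel_iff[OF c])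
    then show False using y by simp
  qed
  have "{(x, y) \<in> carrier_vec n \<times> carrier_vec m.
      Suc (vec_space.rank n (c + outer x y)) = vec_space.rank n c}
    = (SIGMA x: ?R - {0\<^sub>v n}. {y \<in> ?P. y \<bullet> pre x = - 1})" (is "?L = ?S")
  proof (intro equalityI subsetI)
    fix p assume p: "p \<in> ?L"
    obtain x y where xy: "p = (x, y)" by (cases p)
    have xc: "x \<in> carrier_vec n" and yc: "y \<in> carrier_vec m"
      and "Suc (vec_space.rank n (c + outer x y)) = vec_space.rank n c" using p xy by auto
    then obtain u where u: "u \<in> carrier_vec m" "x = c *\<^sub>v u" and y: "y \<in> ?P" "y \<bullet> u = - 1"
      using rank_add_outer_cases(2)[OF xc yc] by blast
    show "p \<in> ?S" using u y same[OF u(1) y(1)] nz[OF u(1) y] xy by auto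
  next
    fix p assume p: "p \<in> ?S"
    obtain x y where xy: "p = (x, y)" by (cases p)
    have x: "x \<in> ?R" and y: "y \<in> ?P" "y \<bullet> pre x = - 1" using p xy by auto
    have xc: "x \<in> carrier_vec n" using x Rc by blast
    have yc: "y \<in> carrier_vec m" using y by (simp add: perp_def)
    have "Suc (vec_space.rank n (c + outer x y)) = vec_space.rank n c"
      unfolding rank_add_outer_cases(2)[OF xc yc] using pre[OF x] y by metis
    then show "p \<in> ?L" using xc yc xy by simp
  qed
  moreover have "card {y \<in> ?P. y \<bullet> pre x = - 1} = CARD('a) ^ (vec_space.rank n c - 1)"
    if "x \<in> ?R - {0\<^sub>v n}" for x
    by (rule card_perp_fibre) (use pre[of x] that in auto)
  moreover have "finite {y \<in> ?P. y \<bullet> z = - 1}" for z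
    by (rule finite_subspace[of _ m]) (auto simp: perp_def)
  moreover have "0\<^sub>v n \<in> ?R"
  proof (rule image_eqI)
    show "0\<^sub>v n = c *\<^sub>v 0\<^sub>v m" by (rule eq_vecI) (use c in auto)
  qed simp
  ultimately show ?thesis
    using fR by (simp add: card_range_mult_mat_vec[OF c])
qed

lemma rank_le_rows: "vec_space.rank n c \<le> n"
proof -
  have "(*\<^sub>v) c ` carrier_vec m \<subseteq> carrier_vec n" using mult_mat_vec_carrier[OF c] by blast
  from card_mono[OF _ this] have "CARD('a) ^ vec_space.rank n c \<le> CARD('a) ^ n"
    by (simp add: card_range_mult_mat_vec[OF c] card_carrier_vec)
  then show ?thesis using card_field_ge_2[where ?'a = 'a] by simp
qed

end

subsection \<open>Character sums over matrices of fixed rank\<close>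

lemma mat_pairing_eq_sum:
  assumes "a \<in> carrier_mat n m" "b \<in> carrier_mat n m"
  shows "mat_pairing a b = (\<Sum>j<m. \<Sum>i<n. a $$ (i, j) * b $$ (i, j))"
proof -
  have "(transpose_mat a * b) $$ (j, j) = (\<Sum>i<n. a $$ (i, j) * b $$ (i, j))" if "j < m" for j
    using assms that by (simp add: scalar_prod_def atLeast0LessThan)
  then show ?thesis using assms by (simp add: mat_pairing_def mat_trace_def)
qed

lemma mat_pairing_add_right:
  assumes "a \<in> carrier_mat n m" "b \<in> carrier_mat n m" "b' \<in> carrier_mat n m"
  shows "mat_pairing a (b + b') = mat_pairing a b + mat_pairing a b'"
  using assms by (simp add: mat_pairing_eq_sum[of _ n m] distrib_left sum.distrib)

lemma mat_pairing_add_left: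
  assumes "a \<in> carrier_mat n m" "a' \<in> carrier_mat n m" "b \<in> carrier_mat n m"
  shows "mat_pairing (a + a') b = mat_pairing a b + mat_pairing a' b"
  using assms by (simp add: mat_pairing_eq_sum[of _ n m] distrib_right sum.distrib)

lemma mat_pairing_outer:
  assumes a: "a \<in> carrier_mat n m" and x: "x \<in> carrier_vec n" and y: "y \<in> carrier_vec m"
  shows "mat_pairing a (outer x y) = x \<bullet> (a *\<^sub>v y)"
proof -
  have "mat_pairing a (outer x y) = (\<Sum>j<m. \<Sum>i<n. a $$ (i, j) * (x $ i * y $ j))"
    using x y unfolding mat_pairing_eq_sum[OF a outer_carrier[OF x y]]
    by (intro sum.cong refl) (simp add: outer_def)
  also have "\<dots> = (\<Sum>i<n. \<Sum>j<m. x $ i * (a $$ (i, j) * y $ j))"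
    by (subst sum.swap) (simp add: ac_simps)
  also have "\<dots> = x \<bullet> (a *\<^sub>v y)"
    using a y by (simp add: scalar_prod_def atLeast0LessThan sum_distrib_left)
  finally show ?thesis .
qed

text \<open>The usual argument for the vanishing of a nontrivial character sum: reindexing by
  \<open>t\<close> multiplies the sum by \<open>k\<close>.\<close>

lemma sum_eq_0_of_shift:
  fixes \<phi> :: "'b \<Rightarrow> 'c::idom"
  assumes t: "bij_betw t G G" and shift: "\<And>g. g \<in> G \<Longrightarrow> \<phi> (t g) = k * \<phi> g" and k: "k \<noteq> 1"
  shows "sum \<phi> G = 0"
proof -
  have "sum \<phi> G = (\<Sum>g\<in>G. \<phi> (t g))" by (rule sum.reindex_bij_betw[OF t, symmetric])
  also have "\<dots> = k * sum \<phi> G" by (simp add: shift sum_distrib_left)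
  finally have "(k - 1) * sum \<phi> G = 0" by (simp add: algebra_simps)
  then show ?thesis using k by simp
qed

lemma mat_add_cancel:
  fixes a b :: "'a::ab_group_add mat"
  assumes "a \<in> carrier_mat n m" "b \<in> carrier_mat n m"
  shows "a + b - b = a" "a - b + b = a"
  using assms by - (rule eq_matI; simp)+

lemma bij_betw_add_mat:
  fixes b :: "'a::ab_group_add mat"
  assumes b: "b \<in> carrier_mat n m"
  shows "bij_betw (\<lambda>a. a + b) (carrier_mat n m) (carrier_mat n m)"
  by (rule bij_betwI[where g = "\<lambda>a. a - b"])
    (use b in \<open>simp_all add: Pi_iff minus_carrier_mat mat_add_cancel[OF _ b]\<close>)

text \<open>Orthogonality pairs each \<open>b\<close> with \<open>- b\<close>, which has the same
  kernel.\<close>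

lemma rank_uminus_mat:
  fixes b :: "'a::{field,finite} mat"
  assumes b: "b \<in> carrier_mat n m"
  shows "vec_space.rank n (- b) = vec_space.rank n b"
proof -
  have "(- b) *\<^sub>v v = 0\<^sub>v n \<longleftrightarrow> b *\<^sub>v v = 0\<^sub>v n" if v: "v \<in> carrier_vec m" for v
  proof -
    have "(- b) *\<^sub>v v = - (b *\<^sub>v v)" using b v by simp
    moreover have "- w = 0\<^sub>v n \<longleftrightarrow> w = 0\<^sub>v n" if "w \<in> carrier_vec n" for w :: "'a vec"
      using that uminus_zero_vec_eq by blast
    ultimately show ?thesis using mult_mat_vec_carrier[OF b v] by simp
  qed
  then have "mat_kernel (- b) = mat_kernel b"
    using b mat_kernel_iff[of "- b" n m] mat_kernel_iff[OF b] uminus_carrier_mat[OF b] by blast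
  then show ?thesis using rank_eq_of_card_mat_kernel[of b n m "- b" 0 0] b by simp
qed

text \<open>For a matrix of rank \<open>r\<close>, these are the numbers of pairs \<open>(x, y)\<close> for which adding \<open>outer x y\<close>
  raises, respectively lowers, the rank. The truncated exponent \<open>r - 1\<close> is harmless, since
  \<open>down_count q 0 = 0\<close> because of the first factor.\<close>

definition up_count :: "nat \<Rightarrow> nat \<Rightarrow> complex \<Rightarrow> nat \<Rightarrow> complex" where
  "up_count n m q r = (q ^ n - q ^ r) * (q ^ m - q ^ r)"

definition down_count :: "complex \<Rightarrow> nat \<Rightarrow> complex" where
  "down_count q r = (q ^ r - 1) * q ^ (r - 1)"

text \<open>Gives the number of perturbations that keep the rank, as the total minus those that
  raise or lower it.\<close>

lemma card_eq_three_levels: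
  fixes f :: "'b \<Rightarrow> nat"
  assumes P: "finite P" and f: "\<And>p. p \<in> P \<Longrightarrow> f p \<in> {s, Suc s, s - 1}"
  shows "card P = card {p \<in> P. f p = s} + card {p \<in> P. f p = Suc s} + card {p \<in> P. Suc (f p) = s}"
proof -
  have c: "card {p \<in> P. \<phi> p} = (\<Sum>p\<in>P. of_bool (\<phi> p))" for \<phi>
    using P by (simp add: Int_def)
  have "(\<Sum>p\<in>P. 1) = (\<Sum>p\<in>P. of_bool (f p = s) + of_bool (f p = Suc s) + (of_bool (Suc (f p) = s) :: nat))"
  proof (rule sum.cong[OF refl])
    fix p assume "p \<in> P"
    then show "1 = of_bool (f p = s) + of_bool (f p = Suc s) + (of_bool (Suc (f p) = s) :: nat)"
      using f[of p] by (cases s) auto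
  qed
  then show ?thesis unfolding c by (simp only: sum.distrib card_eq_sum)
qed

text \<open>Sorts the counts by the target rank \<open>r\<close>: a perturbation moves the rank by
  at most one, so \<open>b\<close> must have rank \<open>r + 1\<close>, \<open>r\<close> or
  \<open>r - 1\<close>.\<close>

lemma card_rank_add_outer:
  fixes b :: "'a::{field,finite} mat"
  assumes b: "b \<in> carrier_mat n m"
  defines "q \<equiv> of_nat CARD('a)"
  shows "of_nat (card {(x, y) \<in> carrier_vec n \<times> carrier_vec m. vec_space.rank n (b + outer x y) = r})
    = (if vec_space.rank n b = Suc r then down_count q (Suc r) else 0)
    + (if vec_space.rank n b = r then q ^ n * q ^ m - up_count n m q r - down_count q r else 0)
    + (if Suc (vec_space.rank n b) = r then up_count n m q (vec_space.rank n b) else 0)"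
proof -
  let ?P = "carrier_vec n \<times> carrier_vec m :: ('a vec \<times> 'a vec) set"
  let ?rk = "\<lambda>(x, y). vec_space.rank n (b + outer x y)"
  let ?s = "vec_space.rank n b"
  let ?Q = "CARD('a)"
  have Q1: "?Q \<ge> 1" using card_field_ge_2[where ?'a = 'a] by simp
  have fP: "finite ?P" by simp
  have E: "{(x, y) \<in> carrier_vec n \<times> carrier_vec m. vec_space.rank n (b + outer x y) = t} = {p \<in> ?P. ?rk p = t}"
    "{(x, y) \<in> carrier_vec n \<times> carrier_vec m. Suc (vec_space.rank n (b + outer x y)) = t} = {p \<in> ?P. Suc (?rk p) = t}" for t
    by auto
  have cases3: "?rk p \<in> {?s, Suc ?s, ?s - 1}" if "p \<in> ?P" for p
    using rank_add_outer_cases(3)[OF b, of "fst p" "snd p"] that by (cases p) simp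
  have sn: "?s \<le> n" by (rule rank_le_rows[OF b])
  have sm: "?s \<le> m" by (rule vec_space.rank_le_nc[OF b])
  \<comment> \<open>These bounds turn the truncated differences of the two counts into genuine
    complex ones.\<close>
  have "?Q ^ ?s \<le> ?Q ^ n" "?Q ^ ?s \<le> ?Q ^ m" "1 \<le> ?Q ^ ?s"
    using Q1 sn sm by (auto intro: power_increasing)
  then have up: "of_nat (card {p \<in> ?P. ?rk p = Suc ?s}) = up_count n m q ?s"
    and down: "of_nat (card {p \<in> ?P. Suc (?rk p) = ?s}) = down_count q ?s"
    using card_rank_add_outer_up[OF b, unfolded E] card_rank_add_outer_down[OF b, unfolded E]
    by (simp_all only: up_count_def down_count_def q_def of_nat_diff of_nat_mult of_nat_power of_nat_1)
  consider "?s = Suc r" | "?s = r" | "Suc ?s = r" | "?s \<noteq> Suc r" "?s \<noteq> r" "Suc ?s \<noteq> r" by blast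
  then show ?thesis
  proof cases
    case 1
    then have "{p \<in> ?P. ?rk p = r} = {p \<in> ?P. Suc (?rk p) = ?s}" by simp
    then show ?thesis using 1 down unfolding E by simp
  next
    case 2
    have "card ?P = card {p \<in> ?P. ?rk p = r} + card {p \<in> ?P. ?rk p = Suc ?s} + card {p \<in> ?P. Suc (?rk p) = ?s}"
      using card_eq_three_levels[OF fP cases3] 2 by simp
    then have "of_nat (card ?P) = of_nat (card {p \<in> ?P. ?rk p = r}) + (up_count n m q ?s + down_count q ?s)"
      by (simp only: of_nat_add up down add.assoc)
    moreover have "of_nat (card ?P) = q ^ n * q ^ m"
      by (simp add: card_cartesian_product card_carrier_vec q_def)
    ultimately show ?thesis using 2 unfolding E by (simp add: algebra_simps)
  next
    case 3
    then show ?thesis using up unfolding E by auto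
  next
    case 4
    then have "{p \<in> ?P. ?rk p = r} = {}" using cases3 by fastforce
    then have "card {p \<in> ?P. ?rk p = r} = 0" by (simp only: card.empty)
    then show ?thesis using 4 unfolding E by simp
  qed
qed

section \<open>Orthogonality of characters and sums over matrices of fixed rank\<close>

locale nontrivial_character =
  fixes \<chi> :: "'a::{field,finite} \<Rightarrow> complex" and q :: complex
  assumes q_eq: "q = of_nat CARD('a)"
    and char_zero: "\<chi> 0 = 1" and char_add: "\<chi> (x + y) = \<chi> x * \<chi> y"
    and char_nontrivial: "\<exists>x. \<chi> x \<noteq> 1"
begin

lemma sum_char_scalar_prod:
  assumes w: "w \<in> carrier_vec n"
  shows "(\<Sum>x\<in>carrier_vec n. \<chi> (x \<bullet> w)) = (if w = 0\<^sub>v n then q ^ n else 0)"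
proof (cases "w = 0\<^sub>v n")
  case True
  then show ?thesis by (simp add: char_zero card_carrier_vec q_eq)
next
  case False
  then have "\<exists>i<n. w $ i \<noteq> 0" using w eq_vecI[of w "0\<^sub>v n"] by auto
  then obtain i where i: "i < n" "w $ i \<noteq> 0" by blast
  obtain z where z: "\<chi> z \<noteq> 1" using char_nontrivial by blast
  \<comment> \<open>A multiple of a unit vector, chosen so that \<open>x0 \<bullet> w = z\<close>;
    translation by \<open>x0\<close> then multiplies the sum by \<open>\<chi> z\<close>, which is
    not 1.\<close>
  define x0 where "x0 = (z / w $ i) \<cdot>\<^sub>v unit_vec n i"
  have x0: "x0 \<in> carrier_vec n" by (simp add: x0_def)
  have x0w: "x0 \<bullet> w = z" using i w by (simp add: x0_def)
  have "(\<Sum>x\<in>carrier_vec n. \<chi> (x \<bullet> w)) = 0"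
  proof (rule sum_eq_0_of_shift[OF _ _ z])
    show "bij_betw (\<lambda>x. x + x0) (carrier_vec n) (carrier_vec n)"
      by (rule bij_betwI[where g = "\<lambda>x. x - x0"]) (use x0 in simp_all)
    show "\<chi> ((x + x0) \<bullet> w) = \<chi> z * \<chi> (x \<bullet> w)" if "x \<in> carrier_vec n" for x
      using add_scalar_prod_distrib[OF that x0 w] by (simp add: char_add x0w)
  qed
  then show ?thesis using False by simp
qed

lemma sum_char_mat_pairing:
  assumes b: "b \<in> carrier_mat n m"
  shows "(\<Sum>a\<in>carrier_mat n m. \<chi> (mat_pairing a b)) = (if b = 0\<^sub>m n m then q ^ (n * m) else 0)"
proof (cases "b = 0\<^sub>m n m")
  case True
  have "mat_pairing a (0\<^sub>m n m) = 0" if "a \<in> carrier_mat n m" for a :: "'a mat"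
    using that by (simp add: mat_pairing_eq_sum[of a n m])
  then show ?thesis using True by (simp add: char_zero card_carrier_mat q_eq)
next
  case False
  then have "\<exists>i<n. \<exists>j<m. b $$ (i, j) \<noteq> 0" using b eq_matI[of "0\<^sub>m n m" b] by auto
  then obtain i j where ij: "i < n" "j < m" "b $$ (i, j) \<noteq> 0" by blast
  obtain z where z: "\<chi> z \<noteq> 1" using char_nontrivial by blast
  \<comment> \<open>A single nonzero entry, placed where \<open>b\<close> does not vanish and scaled
    so that the pairing with \<open>b\<close> is \<open>z\<close>.\<close>
  define a0 where "a0 = mat n m (\<lambda>(k, l). if l = j then (if k = i then z / b $$ (i, j) else 0) else 0)"
  have a0: "a0 \<in> carrier_mat n m" by (simp add: a0_def)
  have "mat_pairing a0 b = (\<Sum>l<m. \<Sum>k<n. if l = j then (if k = i then z else 0) else 0)"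
    unfolding mat_pairing_eq_sum[OF a0 b] by (intro sum.cong refl) (use ij in \<open>simp add: a0_def\<close>)
  also have "\<dots> = (\<Sum>l<m. if l = j then z else 0)"
    using ij by (intro sum.cong refl) simp
  also have "\<dots> = z" using ij by simp
  finally have a0b: "mat_pairing a0 b = z" .
  have "(\<Sum>a\<in>carrier_mat n m. \<chi> (mat_pairing a b)) = 0"
  proof (rule sum_eq_0_of_shift[OF _ _ z])
    show "bij_betw (\<lambda>a. a + a0) (carrier_mat n m) (carrier_mat n m)"
      by (rule bij_betw_add_mat[OF a0])
    show "\<chi> (mat_pairing (a + a0) b) = \<chi> z * \<chi> (mat_pairing a b)" if "a \<in> carrier_mat n m" for a
      using mat_pairing_add_left[OF that a0 b] by (simp add: char_add a0b)
  qed
  then show ?thesis using False by simp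
qed

text \<open>Takes the matrix \<open>a\<close> itself and not its rank, because dependence on the
  rank alone is a consequence of the polynomial formula proved later.\<close>

definition rank_sum :: "nat \<Rightarrow> nat \<Rightarrow> nat \<Rightarrow> 'a mat \<Rightarrow> complex" where
  "rank_sum n m r a = (\<Sum>b\<in>rank_mats n m r. \<chi> (mat_pairing a b))"

lemma finite_rank_mats [simp]: "finite (rank_mats n m r :: 'a mat set)"
  by (rule finite_subset[OF _ finite_carrier_mat[of n m]]) (simp add: rank_mats_def)

lemma sum_rank_mats: "(\<Sum>b\<in>rank_mats n m r. f b)
    = (\<Sum>b\<in>carrier_mat n m. if vec_space.rank n (b :: 'a mat) = r then f b else 0)"
  unfolding rank_mats_def by (rule sum.inter_filter) simp

text \<open>For fixed \<open>y\<close> the sum over \<open>x\<close> vanishes unless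
  \<open>a *\<^sub>v y\<close> is zero, when it is \<open>q ^ n\<close>. The minus sign is there to
  cancel the contribution of \<open>outer x y\<close> after the shift of \<open>b\<close> in the
  recurrence.\<close>

lemma sum_char_outer:
  assumes a: "a \<in> carrier_mat n m"
  shows "(\<Sum>(x, y)\<in>carrier_vec n \<times> carrier_vec m. \<chi> (- mat_pairing a (outer x y)))
    = q ^ n * of_nat (card (mat_kernel a))"
proof -
  have "(\<Sum>(x, y)\<in>carrier_vec n \<times> carrier_vec m. \<chi> (- mat_pairing a (outer x y)))
      = (\<Sum>x\<in>carrier_vec n. \<Sum>y\<in>carrier_vec m. \<chi> (x \<bullet> - (a *\<^sub>v y)))"
    unfolding sum.cartesian_product[symmetric]
  proof (intro sum.cong refl)
    fix x y :: "'a vec" assume x: "x \<in> carrier_vec n" and y: "y \<in> carrier_vec m"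
    have "dim_vec x = dim_vec (a *\<^sub>v y)" using a x by simp
    then show "\<chi> (- mat_pairing a (outer x y)) = \<chi> (x \<bullet> - (a *\<^sub>v y))"
      by (simp add: mat_pairing_outer[OF a x y])
  qed
  also have "\<dots> = (\<Sum>y\<in>carrier_vec m. \<Sum>x\<in>carrier_vec n. \<chi> (x \<bullet> - (a *\<^sub>v y)))"
    by (rule sum.swap)
  also have "\<dots> = (\<Sum>y\<in>carrier_vec m. if a *\<^sub>v y = 0\<^sub>v n then q ^ n else 0)"
  proof (intro sum.cong refl)
    fix y :: "'a vec" assume y: "y \<in> carrier_vec m"
    have ay: "a *\<^sub>v y \<in> carrier_vec n" by (rule mult_mat_vec_carrier[OF a y])
    then have "- (a *\<^sub>v y) = 0\<^sub>v n \<longleftrightarrow> a *\<^sub>v y = 0\<^sub>v n" using uminus_zero_vec_eq by blast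
    then show "(\<Sum>x\<in>carrier_vec n. \<chi> (x \<bullet> - (a *\<^sub>v y))) = (if a *\<^sub>v y = 0\<^sub>v n then q ^ n else 0)"
      using sum_char_scalar_prod[of "- (a *\<^sub>v y)" n] ay by simp
  qed
  also have "\<dots> = (\<Sum>y\<in>{y \<in> carrier_vec m. a *\<^sub>v y = 0\<^sub>v n}. q ^ n)"
    by (rule sum.inter_filter[symmetric]) simp
  also have "{y \<in> carrier_vec m. a *\<^sub>v y = 0\<^sub>v n} = mat_kernel a"
    using mat_kernel_iff[OF a] by blast
  finally show ?thesis by (simp add: mult.commute)
qed

text \<open>The left-hand side is the product of two sums, over rank-one perturbations \<open>(x, y)\<close> and over
  matrices \<open>c\<close> of rank \<open>r\<close>; collect its terms according to \<open>b = c - outer x y\<close>.\<close>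

lemma rank_sum_recurrence:
  assumes a: "a \<in> carrier_mat n m"
  shows "q ^ n * of_nat (card (mat_kernel a)) * rank_sum n m r a
    = down_count q (Suc r) * rank_sum n m (Suc r) a
    + (q ^ n * q ^ m - up_count n m q r - down_count q r) * rank_sum n m r a
    + (if r = 0 then 0 else up_count n m q (r - 1) * rank_sum n m (r - 1) a)"
proof -
  let ?M = "carrier_mat n m :: 'a mat set"
  let ?P = "carrier_vec n \<times> carrier_vec m :: ('a vec \<times> 'a vec) set"
  let ?rk = "\<lambda>b. vec_space.rank n (b :: 'a mat)"
  let ?N = "\<lambda>b. card {(x, y) \<in> ?P. ?rk (b + outer x y) = r}"
  \<comment> \<open>Replacing \<open>b\<close> by \<open>b + outer x y\<close> moves the
    perturbation from the character into the rank condition.\<close>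
  have shift: "\<chi> (- mat_pairing a (outer x y)) * rank_sum n m r a
      = (\<Sum>b\<in>?M. if ?rk (b + outer x y) = r then \<chi> (mat_pairing a b) else 0)"
    if x: "x \<in> carrier_vec n" and y: "y \<in> carrier_vec m" for x y
  proof -
    have o: "outer x y \<in> ?M" using x y by simp
    have "rank_sum n m r a = (\<Sum>b\<in>?M. if ?rk (b + outer x y) = r
        then \<chi> (mat_pairing a (b + outer x y)) else 0)"
      unfolding rank_sum_def sum_rank_mats
      by (rule sum.reindex_bij_betw[OF bij_betw_add_mat[OF o], symmetric])
    then have "\<chi> (- mat_pairing a (outer x y)) * rank_sum n m r a
      = (\<Sum>b\<in>?M. \<chi> (- mat_pairing a (outer x y)) * (if ?rk (b + outer x y) = r
        then \<chi> (mat_pairing a (b + outer x y)) else 0))"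
      by (simp only: sum_distrib_left)
    also have "\<dots> = (\<Sum>b\<in>?M. if ?rk (b + outer x y) = r then \<chi> (mat_pairing a b) else 0)"
    proof (intro sum.cong refl)
      fix b assume b: "b \<in> ?M"
      have "\<chi> (- mat_pairing a (outer x y)) * \<chi> (mat_pairing a (b + outer x y)) = \<chi> (mat_pairing a b)"
        unfolding mat_pairing_add_right[OF a b o] char_add[symmetric] by simp
      then show "\<chi> (- mat_pairing a (outer x y)) * (if ?rk (b + outer x y) = r
        then \<chi> (mat_pairing a (b + outer x y)) else 0)
        = (if ?rk (b + outer x y) = r then \<chi> (mat_pairing a b) else 0)" by simp
    qed
    finally show ?thesis .
  qed
  have "q ^ n * of_nat (card (mat_kernel a)) * rank_sum n m r a
      = (\<Sum>p\<in>?P. \<chi> (- mat_pairing a (outer (fst p) (snd p))) * rank_sum n m r a)"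
    by (simp add: sum_char_outer[OF a, symmetric] sum_distrib_right case_prod_unfold)
  also have "\<dots> = (\<Sum>p\<in>?P. \<Sum>b\<in>?M. if ?rk (b + outer (fst p) (snd p)) = r then \<chi> (mat_pairing a b) else 0)"
    by (rule sum.cong[OF refl], rule shift) auto
  also have "\<dots> = (\<Sum>b\<in>?M. \<Sum>p\<in>?P. if ?rk (b + outer (fst p) (snd p)) = r then \<chi> (mat_pairing a b) else 0)"
    by (rule sum.swap)
  also have "\<dots> = (\<Sum>b\<in>?M. \<chi> (mat_pairing a b) * of_nat (?N b))"
  proof (intro sum.cong refl)
    fix b assume "b \<in> ?M"
    have "(\<Sum>p\<in>?P. if ?rk (b + outer (fst p) (snd p)) = r then \<chi> (mat_pairing a b) else 0)
      = (\<Sum>p\<in>{p \<in> ?P. ?rk (b + outer (fst p) (snd p)) = r}. \<chi> (mat_pairing a b))"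
      by (rule sum.inter_filter[symmetric]) simp
    also have "{p \<in> ?P. ?rk (b + outer (fst p) (snd p)) = r} = {(x, y) \<in> ?P. ?rk (b + outer x y) = r}"
      by auto
    finally show "(\<Sum>p\<in>?P. if ?rk (b + outer (fst p) (snd p)) = r then \<chi> (mat_pairing a b) else 0)
      = \<chi> (mat_pairing a b) * of_nat (?N b)" by (simp add: mult.commute)
  qed
  \<comment> \<open>Only matrices \<open>b\<close> whose rank is within one of \<open>r\<close>
    contribute. For \<open>r = 0\<close> there is no lower neighbour, and the conditional removes
    the truncated index.\<close>
  also have "\<dots> = (\<Sum>b\<in>?M. down_count q (Suc r) * (if ?rk b = Suc r then \<chi> (mat_pairing a b) else 0)
      + (q ^ n * q ^ m - up_count n m q r - down_count q r) * (if ?rk b = r then \<chi> (mat_pairing a b) else 0)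
      + (if r = 0 then 0 else up_count n m q (r - 1) * (if ?rk b = r - 1 then \<chi> (mat_pairing a b) else 0)))"
  proof (intro sum.cong refl)
    fix b assume b: "b \<in> ?M"
    show "\<chi> (mat_pairing a b) * of_nat (?N b)
      = down_count q (Suc r) * (if ?rk b = Suc r then \<chi> (mat_pairing a b) else 0)
      + (q ^ n * q ^ m - up_count n m q r - down_count q r) * (if ?rk b = r then \<chi> (mat_pairing a b) else 0)
      + (if r = 0 then 0 else up_count n m q (r - 1) * (if ?rk b = r - 1 then \<chi> (mat_pairing a b) else 0))"
      unfolding card_rank_add_outer[OF b, folded q_eq] by (cases r) simp_all
  qed
  also have "\<dots> = down_count q (Suc r) * rank_sum n m (Suc r) a
    + (q ^ n * q ^ m - up_count n m q r - down_count q r) * rank_sum n m r a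
    + (if r = 0 then 0 else up_count n m q (r - 1) * rank_sum n m (r - 1) a)"
    unfolding rank_sum_def sum_rank_mats by (simp only: sum.distrib sum_distrib_left) simp
  finally show ?thesis .
qed

text \<open>Summing over \<open>a\<close> first leaves only the pairs with \<open>b' = - b\<close>,
  and negation preserves the rank.\<close>

lemma sum_rank_sum_mult:
  "(\<Sum>a\<in>carrier_mat n m. rank_sum n m r a * rank_sum n m r' a)
    = (if r = r' then q ^ (n * m) * of_nat (card (rank_mats n m r :: 'a mat set)) else 0)"
proof -
  let ?M = "carrier_mat n m :: 'a mat set"
  let ?R = "\<lambda>r. rank_mats n m r :: 'a mat set"
  have R: "b \<in> ?M" if "b \<in> ?R r" for b r using that by (simp add: rank_mats_def)
  have "(\<Sum>a\<in>?M. rank_sum n m r a * rank_sum n m r' a)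
      = (\<Sum>a\<in>?M. \<Sum>b\<in>?R r. \<Sum>b'\<in>?R r'. \<chi> (mat_pairing a (b + b')))"
    unfolding rank_sum_def sum_product
    by (intro sum.cong refl) (simp add: mat_pairing_add_right[of _ n m] R char_add)
  also have "\<dots> = (\<Sum>b\<in>?R r. \<Sum>b'\<in>?R r'. \<Sum>a\<in>?M. \<chi> (mat_pairing a (b + b')))"
    by (subst sum.swap, rule sum.cong[OF refl], rule sum.swap)
  also have "\<dots> = (\<Sum>b\<in>?R r. \<Sum>b'\<in>?R r'. if b' = - b then q ^ (n * m) else 0)"
  proof (intro sum.cong refl)
    fix b b' assume "b \<in> ?R r" "b' \<in> ?R r'"
    then have b: "b \<in> ?M" "b' \<in> ?M" using R by blast+
    have "b + b' = 0\<^sub>m n m \<longleftrightarrow> b' = - b"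
    proof
      assume eq: "b + b' = 0\<^sub>m n m"
      have "b $$ (i, j) + b' $$ (i, j) = 0" if "i < n" "j < m" for i j
        using arg_cong[OF eq, of "\<lambda>M. M $$ (i, j)"] b that by simp
      then show "b' = - b" using b by (intro eq_matI) (auto simp: eq_neg_iff_add_eq_0 add.commute)
    next
      assume "b' = - b"
      then show "b + b' = 0\<^sub>m n m" using b by (intro eq_matI) auto
    qed
    then show "(\<Sum>a\<in>?M. \<chi> (mat_pairing a (b + b'))) = (if b' = - b then q ^ (n * m) else 0)"
      using sum_char_mat_pairing[of "b + b'" n m] b by simp
  qed
  also have "\<dots> = (\<Sum>b\<in>?R r. if r = r' then q ^ (n * m) else 0)"
  proof (intro sum.cong refl)
    fix b assume b: "b \<in> ?R r"
    then have "- b \<in> ?R r' \<longleftrightarrow> r = r'" by (simp add: rank_mats_def rank_uminus_mat[of b n m])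
    then show "(\<Sum>b'\<in>?R r'. if b' = - b then q ^ (n * m) else 0) = (if r = r' then q ^ (n * m) else 0)"
      by simp
  qed
  also have "\<dots> = (if r = r' then q ^ (n * m) * of_nat (card (?R r)) else 0)"
    by (simp add: mult.commute)
  finally show ?thesis .
qed

end

subsection \<open>Orthogonal polynomials\<close>

text \<open>The recurrence for rank sums, rescaled to have leading coefficient one, with
  \<open>[:0, 1:]\<close> standing for \<open>u(a)\<close>. The case \<open>Suc 0\<close> is the
  general step without a lower term.\<close>

fun rank_poly :: "nat \<Rightarrow> nat \<Rightarrow> complex \<Rightarrow> nat \<Rightarrow> complex poly" where
  "rank_poly n m q 0 = 1"
| "rank_poly n m q (Suc 0) = [:- (q ^ n * q ^ m - up_count n m q 0 - down_count q 0), 1:]"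
| "rank_poly n m q (Suc (Suc r)) =
    [:- (q ^ n * q ^ m - up_count n m q (Suc r) - down_count q (Suc r)), 1:] * rank_poly n m q (Suc r)
    - Polynomial.smult (up_count n m q r * down_count q (Suc r)) (rank_poly n m q r)"

text \<open>The linear factor raises the degree by one and keeps the leading coefficient; the
  subtracted term has degree at most \<open>r\<close>.\<close>

lemma rank_poly_monic: "degree (rank_poly n m q r) = r \<and> Polynomial.coeff (rank_poly n m q r) r = 1"
proof (induction n m q r rule: rank_poly.induct)
  case (3 n m q r)
  let ?p = "[:- (q ^ n * q ^ m - up_count n m q (Suc r) - down_count q (Suc r)), 1:] * rank_poly n m q (Suc r)"
  let ?s = "Polynomial.smult (up_count n m q r * down_count q (Suc r)) (rank_poly n m q r)"
  have "rank_poly n m q (Suc r) \<noteq> 0" using 3 by auto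
  then have dp: "degree ?p = Suc (Suc r)" using 3 by (subst degree_mult_eq) auto
  have "lead_coeff ?p = 1" using 3 by (subst lead_coeff_mult) simp
  then have lp: "Polynomial.coeff ?p (Suc (Suc r)) = 1" by (simp only: dp)
  have ds: "degree ?s \<le> r" using 3 degree_smult_le by metis
  then have "Polynomial.coeff ?s (Suc (Suc r)) = 0" by (intro coeff_eq_0) simp
  then have c: "Polynomial.coeff (?p - ?s) (Suc (Suc r)) = 1" using lp by (simp only: coeff_diff diff_zero)
  have "degree (?p - ?s) \<le> Suc (Suc r)" by (rule degree_diff_le) (use dp ds in simp_all)
  moreover have "Suc (Suc r) \<le> degree (?p - ?s)" by (rule le_degree) (simp only: c one_neq_zero not_False_eq_True)
  ultimately have "degree (?p - ?s) = Suc (Suc r)" by (rule antisym)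
  then show ?case using c unfolding rank_poly.simps by (rule conjI)
qed simp_all

text \<open>By counting, rank 0 forces the kernel to be the whole space; applying the matrix to unit
  vectors then shows that all entries vanish.\<close>

lemma rank_mats_0: "rank_mats n m 0 = {0\<^sub>m n m :: 'a::{field,finite} mat}"
proof (intro equalityI subsetI)
  fix b :: "'a mat" assume "b \<in> rank_mats n m 0"
  then have b: "b \<in> carrier_mat n m" and r: "vec_space.rank n b = 0" by (auto simp: rank_mats_def)
  have sub: "mat_kernel b \<subseteq> carrier_vec m" using mat_kernel_iff[OF b] by blast
  have K: "mat_kernel b = carrier_vec m"
    by (rule card_subset_eq[OF _ sub]) (use card_mat_kernel_mult_rank[OF b] r in \<open>simp_all add: card_carrier_vec\<close>)
  have "b $$ (i, j) = 0" if "i < n" "j < m" for i j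
  proof -
    have "unit_vec m j \<in> mat_kernel b" using that K by simp
    then have "(b *\<^sub>v unit_vec m j) $ i = 0" using that by (simp add: mat_kernel_iff[OF b])
    then show ?thesis using that b by simp
  qed
  then have "b = 0\<^sub>m n m" using b by (intro eq_matI) auto
  then show "b \<in> {0\<^sub>m n m}" by simp
qed (simp add: rank_mats_def vec_space.rank_0I)

section \<open>Rank sums as polynomials in the kernel size\<close>

context nontrivial_character
begin

lemma q_neq: "q \<noteq> 0" "q ^ Suc k \<noteq> 1"
proof -
  have Q: "CARD('a) \<ge> 2" by (rule card_field_ge_2)
  show "q \<noteq> 0" by (simp add: q_eq)
  have "1 < CARD('a) ^ Suc k" using Q by (intro one_less_power) auto
  then have "of_nat (CARD('a) ^ Suc k) \<noteq> (1 :: complex)" by (metis of_nat_1_eq_iff less_irrefl)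
  then show "q ^ Suc k \<noteq> 1" by (simp add: q_eq)
qed

text \<open>The product of the leading coefficients in the recurrence, hence the factor that makes a
  rank sum a monic polynomial.\<close>

definition down_prod :: "nat \<Rightarrow> complex" where
  "down_prod r = (\<Prod>i<r. down_count q (Suc i))"

lemma down_count_neq: "down_count q (Suc r) \<noteq> 0"
  using q_neq by (simp add: down_count_def)

lemma down_prod_neq: "down_prod r \<noteq> 0"
  using down_count_neq by (simp add: down_prod_def)

lemma rank_sum_0: "rank_sum n m 0 a = 1" if "a \<in> carrier_mat n m"
  using that by (simp add: rank_sum_def rank_mats_0 mat_pairing_eq_sum[of a n m] char_zero)

text \<open>Solve the recurrence for its highest term and multiply by \<open>down_prod\<close>; the
  result is the recursion of \<open>rank_poly\<close>.\<close>

lemma rank_sum_poly: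
  assumes a: "a \<in> carrier_mat n m"
  shows "down_prod r * rank_sum n m r a = poly (rank_poly n m q r) (q ^ n * of_nat (card (mat_kernel a)))"
proof (induction r rule: induct_nat_012)
  case 0
  show ?case using a by (simp add: down_prod_def rank_sum_0)
next
  case 1
  show ?case using rank_sum_recurrence[OF a, of 0] by (simp add: down_prod_def rank_sum_0[OF a] algebra_simps)
next
  case (ge2 r)
  let ?u = "q ^ n * of_nat (card (mat_kernel a))" and ?F = "\<lambda>r. rank_sum n m r a"
  let ?E = "q ^ n * q ^ m - up_count n m q (Suc r) - down_count q (Suc r)"
  have dp: "down_prod (Suc i) = down_prod i * down_count q (Suc i)" for i
    by (simp add: down_prod_def)
  have rec: "?u * ?F (Suc r) = down_count q (Suc (Suc r)) * ?F (Suc (Suc r))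
      + ?E * ?F (Suc r) + up_count n m q r * ?F r"
    using rank_sum_recurrence[OF a, of "Suc r"] by simp
  have "down_prod (Suc (Suc r)) * ?F (Suc (Suc r))
      = down_prod (Suc r) * (down_count q (Suc (Suc r)) * ?F (Suc (Suc r)))"
    by (simp only: dp[of "Suc r"] mult.assoc)
  also have "down_count q (Suc (Suc r)) * ?F (Suc (Suc r)) = (?u - ?E) * ?F (Suc r) - up_count n m q r * ?F r"
    using rec by (simp only: algebra_simps)
  also have "down_prod (Suc r) * ((?u - ?E) * ?F (Suc r) - up_count n m q r * ?F r)
      = (?u - ?E) * (down_prod (Suc r) * ?F (Suc r))
        - up_count n m q r * down_count q (Suc r) * (down_prod r * ?F r)"
    unfolding dp[of r] by (simp only: right_diff_distrib mult.assoc mult.commute mult.left_commute)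
  also have "\<dots> = poly (rank_poly n m q (Suc (Suc r))) ?u"
    unfolding ge2 by (simp add: algebra_simps)
  finally show ?case .
qed

text \<open>Apply the recurrence to either factor of the product of consecutive rank sums.\<close>

lemma card_rank_mats_Suc:
  "down_count q (Suc r) * of_nat (card (rank_mats n m (Suc r) :: 'a mat set))
    = up_count n m q r * of_nat (card (rank_mats n m r :: 'a mat set))"
proof -
  let ?M = "carrier_mat n m :: 'a mat set"
  let ?F = "rank_sum n m" and ?u = "\<lambda>a. q ^ n * of_nat (card (mat_kernel a))"
  let ?E = "\<lambda>r. q ^ n * q ^ m - up_count n m q r - down_count q r"
  have "(\<Sum>a\<in>?M. ?u a * ?F r a * ?F (Suc r) a) = (\<Sum>a\<in>?M.
      down_count q (Suc r) * (?F (Suc r) a * ?F (Suc r) a) + ?E r * (?F r a * ?F (Suc r) a)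
      + (if r = 0 then 0 else up_count n m q (r - 1)) * (?F (r - 1) a * ?F (Suc r) a))"
    by (intro sum.cong refl, subst rank_sum_recurrence) (auto simp: algebra_simps)
  \<comment> \<open>Orthogonality leaves only the product of two rank sums of the same rank.\<close>
  also have "\<dots> = down_count q (Suc r) * (q ^ (n * m) * of_nat (card (rank_mats n m (Suc r) :: 'a mat set)))"
    by (simp only: sum.distrib sum_distrib_left[symmetric] sum_rank_sum_mult) simp
  finally have 1: "(\<Sum>a\<in>?M. ?u a * ?F r a * ?F (Suc r) a) = \<dots>" .
  have "(\<Sum>a\<in>?M. ?u a * ?F r a * ?F (Suc r) a) = (\<Sum>a\<in>?M. ?u a * ?F (Suc r) a * ?F r a)"
    by (simp only: ac_simps)
  also have "\<dots> = (\<Sum>a\<in>?M.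
      down_count q (Suc (Suc r)) * (?F (Suc (Suc r)) a * ?F r a) + ?E (Suc r) * (?F (Suc r) a * ?F r a)
      + up_count n m q r * (?F r a * ?F r a))"
    by (intro sum.cong refl, subst rank_sum_recurrence) (auto simp: algebra_simps)
  also have "\<dots> = up_count n m q r * (q ^ (n * m) * of_nat (card (rank_mats n m r :: 'a mat set)))"
    by (simp only: sum.distrib sum_distrib_left[symmetric] sum_rank_sum_mult) simp
  finally show ?thesis using 1 q_neq(1) by simp
qed

section \<open>Closed forms of the normalising factor and the rank counts\<close>

lemma down_prod_eq: "down_prod r = (-1) ^ r * q ^ (r choose 2) * q_pochhammer q q r"
proof (induction r)
  case (Suc r)
  have "down_prod (Suc r) = down_prod r * ((q * q ^ r - 1) * q ^ r)"
    by (simp add: down_prod_def down_count_def)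
  then show ?case
    by (simp add: Suc.IH q_pochhammer_def numeral_2_eq_2 power_add algebra_simps)
qed (simp add: down_prod_def q_pochhammer_def numeral_2_eq_2)

lemma q_pochhammer_self_neq: "q_pochhammer q q r \<noteq> 0"
  using down_prod_neq[of r] by (auto simp: down_prod_eq)

text \<open>Both sides have the same ratio of consecutive terms. For \<open>r\<close> above
  \<open>n\<close> both are zero, since the numerator of the q-binomial then contains the factor
  \<open>1 - q ^ n * inverse q ^ n\<close>.\<close>

lemma card_rank_mats:
  "of_nat (card (rank_mats n m r :: 'a mat set))
    = (-1) ^ r * q ^ (r choose 2) * q_pochhammer (q ^ m) (inverse q) r * q_binomial q n r"
proof (induction r)
  case 0
  show ?case by (simp add: rank_mats_0 q_pochhammer_def q_binomial_def numeral_2_eq_2)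
next
  case (Suc r)
  let ?P = "q_pochhammer (q ^ m) (inverse q)" and ?N = "q_pochhammer (q ^ n) (inverse q)"
    and ?D = "q_pochhammer q q"
  have S: "?P (Suc r) = ?P r * (1 - q ^ m * inverse q ^ r)" "?N (Suc r) = ?N r * (1 - q ^ n * inverse q ^ r)"
    "?D (Suc r) = ?D r * (1 - q * q ^ r)"
    by (simp_all add: q_pochhammer_def)
  have "q * q ^ r \<noteq> 1" using q_neq(2)[of r] by simp
  then have nz: "1 - q * q ^ r \<noteq> 0" "q * q ^ r - 1 \<noteq> 0" "?D r \<noteq> 0" "q ^ r \<noteq> 0" "q \<noteq> 0"
    using q_neq q_pochhammer_self_neq by auto
  \<comment> \<open>Two powers \<open>q ^ r\<close>, one of them inside \<open>down_count\<close>,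
    clear the inverses and produce the two differences in \<open>up_count\<close>.\<close>
  have key: "(-1) * q ^ r * (1 - q ^ m * inverse q ^ r) * (1 - q ^ n * inverse q ^ r) * down_count q (Suc r)
      = up_count n m q r * (1 - q * q ^ r)"
    using nz by (simp add: down_count_def up_count_def field_simps)
  have "down_count q (Suc r) * ((-1) ^ Suc r * q ^ (Suc r choose 2) * ?P (Suc r) * q_binomial q n (Suc r))
      = (-1) ^ r * q ^ (r choose 2) * ?P r * ?N r
        * ((-1) * q ^ r * (1 - q ^ m * inverse q ^ r) * (1 - q ^ n * inverse q ^ r) * down_count q (Suc r))
        / (?D r * (1 - q * q ^ r))"
    by (simp add: q_binomial_def S numeral_2_eq_2 power_add)
  also have "\<dots> = up_count n m q r * ((-1) ^ r * q ^ (r choose 2) * ?P r * q_binomial q n r)"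
    unfolding key using nz by (simp add: q_binomial_def)
  also have "\<dots> = down_count q (Suc r) * of_nat (card (rank_mats n m (Suc r) :: 'a mat set))"
    by (simp only: card_rank_mats_Suc Suc.IH)
  finally show ?case unfolding mult_left_cancel[OF down_count_neq[of r]] by (rule sym)
qed

text \<open>Expand \<open>g\<close> in the monic polynomials \<open>rank_poly\<close>: orthogonality
  kills all terms of degree below \<open>r\<close>, and the term of degree \<open>r\<close> carries
  the coefficient of \<open>g\<close>.\<close>

lemma sum_poly_rank_sum:
  assumes g: "degree g \<le> r"
  shows "(\<Sum>a\<in>carrier_mat n m. poly g (q ^ n * of_nat (card (mat_kernel a))) * rank_sum n m r a)
    = Polynomial.coeff g r * (down_prod r * q ^ (n * m) * of_nat (card (rank_mats n m r :: 'a mat set)))"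
proof -
  let ?M = "carrier_mat n m :: 'a mat set"
  let ?u = "\<lambda>a. q ^ n * of_nat (card (mat_kernel a))"
  let ?K = "down_prod r * q ^ (n * m) * of_nat (card (rank_mats n m r :: 'a mat set))"
  \<comment> \<open>Induction on a strict degree bound \<open>d\<close>, so that
    \<open>d = 0\<close> means the zero polynomial; the target is \<open>d = Suc r\<close>.\<close>
  have "(\<Sum>a\<in>?M. poly g (?u a) * rank_sum n m r a) = Polynomial.coeff g r * ?K"
    if "\<And>i. i \<ge> d \<Longrightarrow> Polynomial.coeff g i = 0" "d \<le> Suc r" for d g
    using that
  proof (induction d arbitrary: g)
    case 0
    then have "g = 0" by (intro poly_eqI) simp
    then show ?case by simp
  next
    case (Suc d)
    \<comment> \<open>Subtracting this multiple cancels the coefficient of degree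
      \<open>d\<close>.\<close>
    define g' where "g' = g - Polynomial.smult (Polynomial.coeff g d) (rank_poly n m q d)"
    have c: "Polynomial.coeff (rank_poly n m q d) d = 1" and deg: "degree (rank_poly n m q d) = d"
      using rank_poly_monic by auto
    have g'0: "Polynomial.coeff g' i = 0" if "i \<ge> d" for i
    proof (cases "i = d")
      case True
      then show ?thesis by (simp add: g'_def c)
    next
      case False
      then have "Polynomial.coeff (rank_poly n m q d) i = 0" using that deg by (intro coeff_eq_0) simp
      then show ?thesis using Suc.prems(1)[of i] that False by (simp add: g'_def)
    qed
    have IH: "(\<Sum>a\<in>?M. poly g' (?u a) * rank_sum n m r a) = Polynomial.coeff g' r * ?K"
      by (rule Suc.IH) (use g'0 Suc.prems in auto)
    have "Polynomial.coeff g' r = 0" using g'0 Suc.prems(2) by simp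
    have "(\<Sum>a\<in>?M. poly g (?u a) * rank_sum n m r a)
        = (\<Sum>a\<in>?M. poly g' (?u a) * rank_sum n m r a
            + Polynomial.coeff g d * down_prod d * (rank_sum n m d a * rank_sum n m r a))"
      by (intro sum.cong refl)
        (simp add: g'_def rank_sum_poly[symmetric] algebra_simps)
    also have "\<dots> = Polynomial.coeff g d * down_prod d * (if d = r then q ^ (n * m) * of_nat (card (rank_mats n m d :: 'a mat set)) else 0)"
      by (simp only: sum.distrib IH \<open>Polynomial.coeff g' r = 0\<close> sum_distrib_left[symmetric] sum_rank_sum_mult) simp
    also have "\<dots> = Polynomial.coeff g r * ?K"
      using Suc.prems by (cases "d = r") auto
    finally show ?case .
  qed
  from this[of "Suc r" g] show ?thesis using g by (simp add: coeff_eq_0)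
qed

text \<open>After normalisation the product is a monic polynomial of degree \<open>sum rs I\<close>,
  so its coefficient of degree \<open>r\<close> is 1 or 0.\<close>

lemma sum_prod_rank_sum:
  fixes rs :: "'b \<Rightarrow> nat"
  assumes I: "finite I" and le: "sum rs I \<le> r"
  shows "(\<Sum>a\<in>carrier_mat n m. (\<Prod>i\<in>I. rank_sum n m (rs i) a) * rank_sum n m r a)
    = (if sum rs I = r then down_prod r * q ^ (n * m) * of_nat (card (rank_mats n m r :: 'a mat set))
        / (\<Prod>i\<in>I. down_prod (rs i)) else 0)"
proof -
  let ?M = "carrier_mat n m :: 'a mat set"
  let ?u = "\<lambda>a. q ^ n * of_nat (card (mat_kernel a))"
  let ?D = "\<Prod>i\<in>I. down_prod (rs i)"
  define g where "g = (\<Prod>i\<in>I. rank_poly n m q (rs i))"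
  have D0: "?D \<noteq> 0" using I down_prod_neq by simp
  have "rank_poly n m q t \<noteq> 0" for t using rank_poly_monic[of n m q t] by auto
  then have deg: "degree g = sum rs I"
    unfolding g_def by (subst degree_prod_eq_sum_degree) (simp_all add: rank_poly_monic)
  have "lead_coeff g = 1" unfolding g_def lead_coeff_prod by (simp add: rank_poly_monic)
  then have c: "Polynomial.coeff g r = (if sum rs I = r then 1 else 0)"
    using deg le by (auto simp: coeff_eq_0)
  have "?D * (\<Sum>a\<in>?M. (\<Prod>i\<in>I. rank_sum n m (rs i) a) * rank_sum n m r a)
      = (\<Sum>a\<in>?M. poly g (?u a) * rank_sum n m r a)"
    unfolding sum_distrib_left
    by (intro sum.cong refl)
      (simp add: g_def poly_prod rank_sum_poly[symmetric] prod.distrib mult.assoc)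
  also have "\<dots> = Polynomial.coeff g r * (down_prod r * q ^ (n * m) * of_nat (card (rank_mats n m r :: 'a mat set)))"
    by (rule sum_poly_rank_sum) (use deg le in simp)
  finally show ?thesis using D0 unfolding c by (auto simp: field_simps)
qed

text \<open>Equal ranks give kernels of equal size, and the rank sum is a polynomial in that size.
  This justifies the choice of representative in \<open>canonical_matrix\<close>.\<close>

lemma rank_sum_cong:
  assumes a: "a \<in> rank_mats n m s" and b: "b \<in> rank_mats n m s"
  shows "rank_sum n m r a = rank_sum n m r b"
proof -
  have ab: "a \<in> carrier_mat n m" "b \<in> carrier_mat n m" using a b by (auto simp: rank_mats_def)
  have "card (mat_kernel a) * CARD('a) ^ s = card (mat_kernel b) * CARD('a) ^ s"
    using card_mat_kernel_mult_rank[OF ab(1)] card_mat_kernel_mult_rank[OF ab(2)] a b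
    by (simp add: rank_mats_def)
  then have "card (mat_kernel a) = card (mat_kernel b)" by simp
  then have "down_prod r * rank_sum n m r a = down_prod r * rank_sum n m r b"
    using ab by (simp add: rank_sum_poly)
  then show ?thesis using down_prod_neq by simp
qed

end

text \<open>Accounts for the cross terms in the final exponent, which arise when the normalising
  factors are divided out.\<close>

lemma sum_choose_2:
  fixes rs :: "nat \<Rightarrow> nat" and k :: nat
  shows "(\<Sum>i=1..k. rs i) choose 2 = (\<Sum>i=1..k. rs i choose 2) + (\<Sum>j=1..k. \<Sum>i=1..<j. rs i * rs j)"
proof (induction k)
  case (Suc k)
  have add: "(a + b) choose 2 = (a choose 2) + (b choose 2) + a * b" for a b :: nat
    by (induction b) (simp_all add: numeral_2_eq_2)
  have "{1..<Suc k} = {1..k}" by auto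
  then show ?case using Suc.IH by (simp add: add sum_distrib_right)
qed (simp add: numeral_2_eq_2)

theorem proposition5p2p4:
  fixes \<theta> :: "'a::{field,finite} \<Rightarrow> complex"
    and q :: complex
    and n m k r :: nat
    and rs :: "nat \<Rightarrow> nat"
  assumes "q = of_nat (CARD('a))"
    and "nontrivial_additive_character \<theta>"
    and "n \<le> m"
    and "k \<ge> 1"
    and "\<And>i. i \<in> {1..k} \<Longrightarrow> rs i \<le> n"
    and "r \<le> n"
    and "(\<Sum>i=1..k. rs i) \<le> r"
  shows "(\<Sum>s=0..n. (-1) ^ s * q ^ (s choose 2) * q_pochhammer (q ^ m) (inverse q) s
            * q_binomial q n s * (\<Prod>i=1..k. canonical_matrix \<theta> n m s (rs i))
            * canonical_matrix \<theta> n m s r)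
       = (if (\<Sum>i=1..k. rs i) = r then 1 else 0)
         * ((-1) ^ r * q ^ (n * m + (r choose 2) + (\<Sum>j=1..k. \<Sum>i=1..<j. rs i * rs j))
            * (q_pochhammer (q ^ m) (inverse q) r * q_pochhammer (q ^ n) (inverse q) r
               / (\<Prod>i=1..k. q_pochhammer q q (rs i))))"
proof -
  interpret nontrivial_character "\<lambda>x. cnj (\<theta> x)" q
  proof
    have \<theta>: "\<theta> x \<noteq> 0" "\<theta> (x + y) = \<theta> x * \<theta> y" "\<exists>x. \<theta> x \<noteq> 1" for x y
      using assms(2) by (auto simp: nontrivial_additive_character_def)
    show "q = of_nat CARD('a)" by (rule assms(1))
    show "cnj (\<theta> (x + y)) = cnj (\<theta> x) * cnj (\<theta> y)" for x y by (simp add: \<theta>(2))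
    \<comment> \<open>A nonzero idempotent of a field is 1.\<close>
    have "\<theta> 0 * \<theta> 0 = \<theta> 0" using \<theta>(2)[of 0 0] by simp
    then show "cnj (\<theta> 0) = 1" using \<theta>(1)[of 0] by simp
    show "\<exists>x. cnj (\<theta> x) \<noteq> 1" using \<theta>(3) by (metis complex_cnj_cancel_iff complex_cnj_one)
  qed
  let ?M = "carrier_mat n m :: 'a mat set"
  let ?G = "\<lambda>s. (\<Prod>i=1..k. canonical_matrix \<theta> n m s (rs i)) * canonical_matrix \<theta> n m s r"
  have canon: "canonical_matrix \<theta> n m s t = rank_sum n m t a" if a: "a \<in> rank_mats n m s" for s t a
  proof -
    have "(SOME a. a \<in> rank_mats n m s) \<in> (rank_mats n m s :: 'a mat set)" by (rule someI[where P = "\<lambda>a. a \<in> rank_mats n m s", OF a])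
    from rank_sum_cong[OF this a] show ?thesis
      by (simp add: canonical_matrix_def rank_sum_def Let_def)
  qed
  have "(\<Sum>s=0..n. (-1) ^ s * q ^ (s choose 2) * q_pochhammer (q ^ m) (inverse q) s
            * q_binomial q n s * (\<Prod>i=1..k. canonical_matrix \<theta> n m s (rs i))
            * canonical_matrix \<theta> n m s r)
      = (\<Sum>s=0..n. \<Sum>a\<in>{a \<in> ?M. vec_space.rank n a = s}. ?G (vec_space.rank n a))"
  \<comment> \<open>The coefficient of the summand is the number of matrices of rank
    \<open>s\<close>, so the sum over \<open>s\<close> becomes a sum over all matrices grouped by
    rank.\<close>
  proof (intro sum.cong refl)
    fix s
    have "(\<Sum>a\<in>{a \<in> ?M. vec_space.rank n a = s}. ?G (vec_space.rank n a))
        = of_nat (card (rank_mats n m s :: 'a mat set)) * ?G s"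
      by (simp add: rank_mats_def)
    then show "(-1) ^ s * q ^ (s choose 2) * q_pochhammer (q ^ m) (inverse q) s
            * q_binomial q n s * (\<Prod>i=1..k. canonical_matrix \<theta> n m s (rs i))
            * canonical_matrix \<theta> n m s r
      = (\<Sum>a\<in>{a \<in> ?M. vec_space.rank n a = s}. ?G (vec_space.rank n a))"
      by (simp only: card_rank_mats mult.assoc)
  qed
  also have "\<dots> = (\<Sum>a\<in>?M. ?G (vec_space.rank n a))"
    by (rule sum.group) (auto intro: rank_le_rows)
  also have "\<dots> = (\<Sum>a\<in>?M. (\<Prod>i=1..k. rank_sum n m (rs i) a) * rank_sum n m r a)"
  proof (intro sum.cong refl)
    fix a assume "a \<in> ?M"
    then have "a \<in> rank_mats n m (vec_space.rank n a)" by (simp add: rank_mats_def)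
    from canon[OF this] show "?G (vec_space.rank n a) = (\<Prod>i=1..k. rank_sum n m (rs i) a) * rank_sum n m r a"
      by simp
  qed
  also have "\<dots> = (if (\<Sum>i=1..k. rs i) = r then down_prod r * q ^ (n * m) * of_nat (card (rank_mats n m r :: 'a mat set))
        / (\<Prod>i=1..k. down_prod (rs i)) else 0)"
    by (rule sum_prod_rank_sum) (use assms(7) in simp_all)
  also have "\<dots> = (if (\<Sum>i=1..k. rs i) = r then 1 else 0)
         * ((-1) ^ r * q ^ (n * m + (r choose 2) + (\<Sum>j=1..k. \<Sum>i=1..<j. rs i * rs j))
            * (q_pochhammer (q ^ m) (inverse q) r * q_pochhammer (q ^ n) (inverse q) r
               / (\<Prod>i=1..k. q_pochhammer q q (rs i))))"
  proof (cases "(\<Sum>i=1..k. rs i) = r")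
    case True
    let ?c = "\<Sum>i=1..k. rs i choose 2" and ?e = "\<Sum>j=1..k. \<Sum>i=1..<j. rs i * rs j"
    let ?D = "\<Prod>i=1..k. q_pochhammer q q (rs i)"
    have ch: "r choose 2 = ?c + ?e" using sum_choose_2[of rs k] True by simp
    have prod: "(\<Prod>i=1..k. down_prod (rs i)) = (-1) ^ r * q ^ ?c * ?D"
      by (simp add: down_prod_eq prod.distrib power_sum True[symmetric])
    \<comment> \<open>Of the three signs \<open>(-1) ^ r\<close>, two cancel;
      \<open>q_pochhammer q q r\<close> cancels the denominator of the q-binomial; and one of the
      two exponents \<open>r choose 2\<close> loses \<open>?c\<close>, leaving
      \<open>?e\<close>.\<close>
    have nz: "?D \<noteq> 0" "q \<noteq> 0" "q_pochhammer q q r \<noteq> 0" "((-1) ^ r * (-1) ^ r :: complex) = 1"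
      using q_pochhammer_self_neq q_neq by (simp_all add: power_mult_distrib[symmetric])
    show ?thesis
      unfolding prod card_rank_mats down_prod_eq[of r] q_binomial_def ch
      using True nz by (simp add: power_add field_simps)
  qed simp
  finally show ?thesis .
qed

end
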